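(* Let $\mathbb{F}$ be an algebraically closed field of characteristic $0$ and let $n\geq 2$. The following elements $\theta$ of $\mathsf{Z}^2_{\mathrm{LC}}(\mu_0^n,\mathbb{F})$ parameterize (via $\theta\mapsto\langle[\theta]\rangle$) the distinct orbits of $\mathsf{Aut}(\mu_0^n)$ on the subset $T_1(\mu_0^n)$ of the Grassmannian $G_1(\mathsf{H}^2_{\mathrm{LC}}(\mu_0^n,\mathbb{F}))$, i.e. each orbit contains $\langle[\theta]\rangle$ for exactly one $\theta$ in the list; equivalently, the algebras $(\mu_0^n)_\theta$, for $\theta$ in the list, parameterize the distinct isomorphism classes of non-split left commutative central extensions of $\mu_0^n$ with $1$-dimensional annihilator: (a) $\Delta_{n,1}$; (b) $\nabla_n+\mu\Delta_{n,1}$ with $\mu\in\mathbb{F}$ (where $\mu=0$ gives the trivial extension $\mu_0^{n+1}$); (c) $\nabla_n+\Delta_{i,1}$ with $2\leq i\leq n-1$. In the bicommutative case (that is, with $\mathsf{Z}^2_{\mathrm{BC}}$, $\mathsf{H}^2_{\mathrm{BC}}$ in place of $\mathsf{Z}^2_{\mathrm{LC}}$, $\mathsf{H}^2_{\mathrm{LC}}$, and non-split bicommutative central extensions with $1$-dimensional annihilator), the corresponding complete list of representatives is: - if $n=2$: $\Delta_{2,1}$, and $\nabla_2+\mu\Delta_{2,1}$ with $\mu\in\mathbb{F}$ (where $\mu=0$ gives the trivial extension $\mu_0^3$); - if $n>2$: $\nabla_n$ (the trivial extension $\mu_0^{n+1}$), and $\nabla_n+\Delta_{2,1}$.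
   Context: Algebras are not necessarily associative. $\mu_0^n$ is the $n$-dimensional (associative, commutative) null-filiform algebra over $\mathbb{F}$ with basis $e_1,\dots,e_n$ and product $e_ie_j=e_{i+j}$, where $e_m=0$ for $m>n$. $\mathsf{Aut}(\mu_0^n)$ is its group of algebra automorphisms. An algebra is left commutative (LC) if $x(yz)=y(xz)$ for all $x,y,z$, right commutative if $(xy)z=(xz)y$ for all $x,y,z$, and bicommutative (BC) if it is both. For an algebra $A$ and a vector space $V$, a bilinear map $\theta:A\times A\to V$ lies in $\mathsf{Z}^2_{\mathrm{LC}}(A,V)$ (for $A$ left commutative) if $\theta(x,yz)=\theta(y,xz)$ for all $x,y,z\in A$; it lies in $\mathsf{Z}^2_{\mathrm{BC}}(A,V)$ (for $A$ bicommutative) if moreover $\theta(xy,z)=\theta(xz,y)$ for all $x,y,z\in A$. Coboundaries are $\mathsf{B}^2(A,V)=\{\delta f: f\in\mathrm{Hom}(A,V)\}$ with $(\delta f)(x,y)=f(xy)$. For $M\in\{\mathrm{LC},\mathrm{BC}\}$, $\mathsf{H}^2_M(A,V)=\mathsf{Z}^2_M(A,V)/\mathsf{B}^2(A,V)$, and $[\theta]$ denotes the class of $\theta$. For $1\le i,j\le n$, $\Delta_{i,j}$ is the bilinear form on $\mu_0^n$ with $\Delta_{i,j}(e_l,e_m)=\delta_{i,l}\delta_{j,m}$, and $\nabla_j=\sum_{k=1}^{j}\Delta_{k,j+1-k}$ for $1\le j\le n$. $\mathsf{Aut}(A)$ acts on cocycles by $(\phi\cdot\theta)(x,y)=\theta(\phi(x),\phi(y))$;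 this induces an action on $\mathsf{H}^2_M(A,\mathbb{F})$ and on the set $G_1(\mathsf{H}^2_M(A,\mathbb{F}))$ of its $1$-dimensional subspaces. (Although this is a right action, it is written on the left.) The annihilators are $\mathrm{Ann}(A)=\{x\in A: xA+Ax=0\}$ and $\mathrm{Ann}(\theta)=\{x\in A:\theta(x,A)+\theta(A,x)=0\}$. One sets $T_1(A)=\{\langle[\theta]\rangle\in G_1(\mathsf{H}^2_M(A,\mathbb{F})): \mathrm{Ann}(\theta)\cap\mathrm{Ann}(A)=0\}$. For a cocycle $\theta\in\mathsf{Z}^2_M(A,V)$, $A_\theta=A\oplus V$ with product $[x+v,y+w]_\theta=xy+\theta(x,y)$; it is a central extension of $A$ by $V$ in the variety. A central extension $E$ is non-split if it has no annihilator component, i.e. there is no nonzero subspace $I\subseteq\mathrm{Ann}(E)$ such that $E=E_0\oplus I$ for some ideal $E_0$ of $E$. *)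

theory Defs
  imports
    Complex_Main
    "HOL-Computational_Algebra.Polynomial"
    "HOL-Library.Function_Algebras"
    "HOL-Library.Product_Plus"
begin

text \<open>
  An algebra over a field \<open>'f\<close> lives on a linear subspace \<open>carr\<close> of an ambient vector space,
  namely the type \<open>'v\<close> with its addition and the scalar multiplication \<open>scl\<close>.
  Only the values of \<open>mul\<close> on \<open>carr\<close> matter.
\<close>

record ('f, 'v) nalg =
  carr :: "'v set"
  scl :: "'f \<Rightarrow> 'v \<Rightarrow> 'v"
  mul :: "'v \<Rightarrow> 'v \<Rightarrow> 'v"

definition linear_from ::
  "('f::field, 'v::ab_group_add) nalg \<Rightarrow> ('f \<Rightarrow> 'w::ab_group_add \<Rightarrow> 'w) \<Rightarrow> ('v \<Rightarrow> 'w) \<Rightarrow> bool" where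
  "linear_from A s f \<longleftrightarrow>
     (\<forall>x\<in>carr A. \<forall>y\<in>carr A. f (x + y) = f x + f y) \<and>
     (\<forall>c. \<forall>x\<in>carr A. f (scl A c x) = s c (f x))"

definition bilinear_from ::
  "('f::field, 'v::ab_group_add) nalg \<Rightarrow> ('f \<Rightarrow> 'w::ab_group_add \<Rightarrow> 'w) \<Rightarrow> ('v \<Rightarrow> 'v \<Rightarrow> 'w) \<Rightarrow> bool" where
  "bilinear_from A s \<theta> \<longleftrightarrow>
     (\<forall>x\<in>carr A. linear_from A s (\<lambda>y. \<theta> x y)) \<and> (\<forall>y\<in>carr A. linear_from A s (\<lambda>x. \<theta> x y))"

definition algebra :: "('f::field, 'v::ab_group_add) nalg \<Rightarrow> bool" where
  "algebra A \<longleftrightarrow>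
     vector_space (scl A) \<and> module.subspace (scl A) (carr A) \<and>
     (\<forall>x\<in>carr A. \<forall>y\<in>carr A. mul A x y \<in> carr A) \<and> bilinear_from A (scl A) (mul A)"

definition isomorphism ::
  "('f::field, 'v::ab_group_add) nalg \<Rightarrow> ('f, 'u::ab_group_add) nalg \<Rightarrow> ('v \<Rightarrow> 'u) \<Rightarrow> bool" where
  "isomorphism A B \<phi> \<longleftrightarrow>
     bij_betw \<phi> (carr A) (carr B) \<and> linear_from A (scl B) \<phi> \<and>
     (\<forall>x\<in>carr A. \<forall>y\<in>carr A. \<phi> (mul A x y) = mul B (\<phi> x) (\<phi> y))"

definition isomorphic ::
  "('f::field, 'v::ab_group_add) nalg \<Rightarrow> ('f, 'u::ab_group_add) nalg \<Rightarrow> bool" where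
  "isomorphic A B \<longleftrightarrow> (\<exists>\<phi>. isomorphism A B \<phi>)"

definition Aut :: "('f::field, 'v::ab_group_add) nalg \<Rightarrow> ('v \<Rightarrow> 'v) set" where
  "Aut A = {\<phi>. isomorphism A A \<phi>}"

definition left_commutative :: "('f::field, 'v::ab_group_add) nalg \<Rightarrow> bool" where
  "left_commutative A \<longleftrightarrow>
     (\<forall>x\<in>carr A. \<forall>y\<in>carr A. \<forall>z\<in>carr A. mul A x (mul A y z) = mul A y (mul A x z))"

definition right_commutative :: "('f::field, 'v::ab_group_add) nalg \<Rightarrow> bool" where
  "right_commutative A \<longleftrightarrow>
     (\<forall>x\<in>carr A. \<forall>y\<in>carr A. \<forall>z\<in>carr A. mul A (mul A x y) z = mul A (mul A x z) y)"

datatype variety = LC | BC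

fun in_variety :: "variety \<Rightarrow> ('f::field, 'v::ab_group_add) nalg \<Rightarrow> bool" where
  "in_variety LC A \<longleftrightarrow> left_commutative A"
| "in_variety BC A \<longleftrightarrow> left_commutative A \<and> right_commutative A"

definition Ann :: "('f::field, 'v::ab_group_add) nalg \<Rightarrow> 'v set" where
  "Ann A = {x\<in>carr A. \<forall>y\<in>carr A. mul A x y = 0 \<and> mul A y x = 0}"

definition ideal_of :: "('f::field, 'v::ab_group_add) nalg \<Rightarrow> 'v set \<Rightarrow> bool" where
  "ideal_of A I \<longleftrightarrow>
     module.subspace (scl A) I \<and> I \<subseteq> carr A \<and>
     (\<forall>x\<in>I. \<forall>y\<in>carr A. mul A x y \<in> I \<and> mul A y x \<in> I)"

definition non_split :: "('f::field, 'v::ab_group_add) nalg \<Rightarrow> bool" where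
  "non_split E \<longleftrightarrow>
     \<not> (\<exists>I E0. module.subspace (scl E) I \<and> I \<noteq> {0} \<and> I \<subseteq> Ann E \<and> ideal_of E E0 \<and>
            E0 \<inter> I = {0} \<and> carr E = {x + v | x v. x \<in> E0 \<and> v \<in> I})"

text \<open>
  The coefficient space \<open>V\<close> is a whole type \<open>'w\<close> with scalar multiplication \<open>s\<close>; the coefficient
  space \<open>'f\<close> is the case \<open>s = (*)\<close>. A map \<open>A \<times> A \<rightarrow> V\<close> is represented by the function that
  extends it by zero outside the carrier, so that the representation is unique and the
  pointwise operations on functions are those of the space of such maps.
\<close>

definition on_carr ::
  "('f::field, 'v::ab_group_add) nalg \<Rightarrow> ('v \<Rightarrow> 'v \<Rightarrow> 'w::ab_group_add) \<Rightarrow> 'v \<Rightarrow> 'v \<Rightarrow> 'w" where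
  "on_carr A \<theta> = (\<lambda>x y. if x \<in> carr A \<and> y \<in> carr A then \<theta> x y else 0)"

definition Bil ::
  "('f::field, 'v::ab_group_add) nalg \<Rightarrow> ('f \<Rightarrow> 'w::ab_group_add \<Rightarrow> 'w) \<Rightarrow> ('v \<Rightarrow> 'v \<Rightarrow> 'w) set" where
  "Bil A s = {\<theta>. bilinear_from A s \<theta> \<and> on_carr A \<theta> = \<theta>}"

definition Z2_LC ::
  "('f::field, 'v::ab_group_add) nalg \<Rightarrow> ('f \<Rightarrow> 'w::ab_group_add \<Rightarrow> 'w) \<Rightarrow> ('v \<Rightarrow> 'v \<Rightarrow> 'w) set" where
  "Z2_LC A s =
     {\<theta> \<in> Bil A s. \<forall>x\<in>carr A. \<forall>y\<in>carr A. \<forall>z\<in>carr A. \<theta> x (mul A y z) = \<theta> y (mul A x z)}"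

definition Z2_BC ::
  "('f::field, 'v::ab_group_add) nalg \<Rightarrow> ('f \<Rightarrow> 'w::ab_group_add \<Rightarrow> 'w) \<Rightarrow> ('v \<Rightarrow> 'v \<Rightarrow> 'w) set" where
  "Z2_BC A s =
     {\<theta> \<in> Z2_LC A s. \<forall>x\<in>carr A. \<forall>y\<in>carr A. \<forall>z\<in>carr A. \<theta> (mul A x y) z = \<theta> (mul A x z) y}"

fun Z2 ::
  "variety \<Rightarrow> ('f::field, 'v::ab_group_add) nalg \<Rightarrow> ('f \<Rightarrow> 'w::ab_group_add \<Rightarrow> 'w) \<Rightarrow>
     ('v \<Rightarrow> 'v \<Rightarrow> 'w) set" where
  "Z2 LC A s = Z2_LC A s"
| "Z2 BC A s = Z2_BC A s"

definition B2 ::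
  "('f::field, 'v::ab_group_add) nalg \<Rightarrow> ('f \<Rightarrow> 'w::ab_group_add \<Rightarrow> 'w) \<Rightarrow> ('v \<Rightarrow> 'v \<Rightarrow> 'w) set" where
  "B2 A s = {on_carr A (\<lambda>x y. f (mul A x y)) | f. linear_from A s f}"

definition cls ::
  "('f::field, 'v::ab_group_add) nalg \<Rightarrow> ('f \<Rightarrow> 'w::ab_group_add \<Rightarrow> 'w) \<Rightarrow>
     ('v \<Rightarrow> 'v \<Rightarrow> 'w) \<Rightarrow> ('v \<Rightarrow> 'v \<Rightarrow> 'w) set" where
  "cls A s \<theta> = {\<theta> + \<beta> | \<beta>. \<beta> \<in> B2 A s}"

definition H2 ::
  "variety \<Rightarrow> ('f::field, 'v::ab_group_add) nalg \<Rightarrow> ('f \<Rightarrow> 'w::ab_group_add \<Rightarrow> 'w) \<Rightarrow>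
     ('v \<Rightarrow> 'v \<Rightarrow> 'w) set set" where
  "H2 M A s = cls A s ` Z2 M A s"

definition bscale :: "('f \<Rightarrow> 'w \<Rightarrow> 'w) \<Rightarrow> 'f \<Rightarrow> ('v \<Rightarrow> 'v \<Rightarrow> 'w) \<Rightarrow> 'v \<Rightarrow> 'v \<Rightarrow> 'w" where
  "bscale s c \<theta> = (\<lambda>x y. s c (\<theta> x y))"

text \<open>
  For a class \<open>h\<close>, the union below is the single class of \<open>c \<cdot> \<theta>\<close> for any \<open>\<theta> \<in> h\<close>;
  \<open>H2_act\<close> is written in the same way.
\<close>

definition H2_scale ::
  "('f::field, 'v::ab_group_add) nalg \<Rightarrow> ('f \<Rightarrow> 'w::ab_group_add \<Rightarrow> 'w) \<Rightarrow>
     'f \<Rightarrow> ('v \<Rightarrow> 'v \<Rightarrow> 'w) set \<Rightarrow> ('v \<Rightarrow> 'v \<Rightarrow> 'w) set" where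
  "H2_scale A s c h = (\<Union>\<theta>\<in>h. cls A s (bscale s c \<theta>))"

definition H2_line ::
  "('f::field, 'v::ab_group_add) nalg \<Rightarrow> ('f \<Rightarrow> 'w::ab_group_add \<Rightarrow> 'w) \<Rightarrow>
     ('v \<Rightarrow> 'v \<Rightarrow> 'w) set \<Rightarrow> ('v \<Rightarrow> 'v \<Rightarrow> 'w) set set" where
  "H2_line A s h = range (\<lambda>c. H2_scale A s c h)"

text \<open>The class \<open>B2 A s\<close> is the zero of \<open>H2 M A s\<close>.\<close>

definition G1 ::
  "variety \<Rightarrow> ('f::field, 'v::ab_group_add) nalg \<Rightarrow> ('f \<Rightarrow> 'w::ab_group_add \<Rightarrow> 'w) \<Rightarrow>
     ('v \<Rightarrow> 'v \<Rightarrow> 'w) set set set" where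
  "G1 M A s = H2_line A s ` (H2 M A s - {B2 A s})"

definition act ::
  "('f::field, 'v::ab_group_add) nalg \<Rightarrow> ('v \<Rightarrow> 'v) \<Rightarrow> ('v \<Rightarrow> 'v \<Rightarrow> 'w::ab_group_add) \<Rightarrow>
     'v \<Rightarrow> 'v \<Rightarrow> 'w" where
  "act A \<phi> \<theta> = on_carr A (\<lambda>x y. \<theta> (\<phi> x) (\<phi> y))"

definition H2_act ::
  "('f::field, 'v::ab_group_add) nalg \<Rightarrow> ('f \<Rightarrow> 'w::ab_group_add \<Rightarrow> 'w) \<Rightarrow>
     ('v \<Rightarrow> 'v) \<Rightarrow> ('v \<Rightarrow> 'v \<Rightarrow> 'w) set \<Rightarrow> ('v \<Rightarrow> 'v \<Rightarrow> 'w) set" where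
  "H2_act A s \<phi> h = (\<Union>\<theta>\<in>h. cls A s (act A \<phi> \<theta>))"

definition Ann_cocycle ::
  "('f::field, 'v::ab_group_add) nalg \<Rightarrow> ('v \<Rightarrow> 'v \<Rightarrow> 'w::ab_group_add) \<Rightarrow> 'v set" where
  "Ann_cocycle A \<theta> = {x\<in>carr A. \<forall>y\<in>carr A. \<theta> x y = 0 \<and> \<theta> y x = 0}"

definition cocycle_line ::
  "('f::field, 'v::ab_group_add) nalg \<Rightarrow> ('v \<Rightarrow> 'v \<Rightarrow> 'f) \<Rightarrow> ('v \<Rightarrow> 'v \<Rightarrow> 'f) set set" where
  "cocycle_line A \<theta> = H2_line A (*) (cls A (*) \<theta>)"

definition T1 ::
  "variety \<Rightarrow> ('f::field, 'v::ab_group_add) nalg \<Rightarrow> ('v \<Rightarrow> 'v \<Rightarrow> 'f) set set set" where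
  "T1 M A = {cocycle_line A \<theta> | \<theta>.
     \<theta> \<in> Z2 M A (*) \<and> cocycle_line A \<theta> \<in> G1 M A (*) \<and> Ann_cocycle A \<theta> \<inter> Ann A = {0}}"

definition orbit ::
  "('f::field, 'v::ab_group_add) nalg \<Rightarrow> ('v \<Rightarrow> 'v \<Rightarrow> 'f) set set \<Rightarrow> ('v \<Rightarrow> 'v \<Rightarrow> 'f) set set set" where
  "orbit A L = {H2_act A (*) \<phi> ` L | \<phi>. \<phi> \<in> Aut A}"

definition parameterizes_orbits ::
  "variety \<Rightarrow> ('f::field, 'v::ab_group_add) nalg \<Rightarrow> ('v \<Rightarrow> 'v \<Rightarrow> 'f) set \<Rightarrow> bool" where
  "parameterizes_orbits M A R \<longleftrightarrow>
     (\<forall>\<theta>\<in>R. \<theta> \<in> Z2 M A (*) \<and> cocycle_line A \<theta> \<in> T1 M A) \<and>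
     (\<forall>X \<in> orbit A ` T1 M A. \<exists>!\<theta>. \<theta> \<in> R \<and> cocycle_line A \<theta> \<in> X)"

definition ext ::
  "('f::field, 'v::ab_group_add) nalg \<Rightarrow> ('f \<Rightarrow> 'w::ab_group_add \<Rightarrow> 'w) \<Rightarrow>
     ('v \<Rightarrow> 'v \<Rightarrow> 'w) \<Rightarrow> ('f, 'v \<times> 'w) nalg" where
  "ext A s \<theta> =
     \<lparr> carr = carr A \<times> UNIV,
       scl = (\<lambda>c (x, v). (scl A c x, s c v)),
       mul = (\<lambda>(x, v) (y, w). (mul A x y, \<theta> x y)) \<rparr>"

text \<open>
  An algebra \<open>E\<close> is a central extension of \<open>A\<close> by \<open>V\<close> if it is, up to isomorphism, of the form
  \<open>A\<^sub>\<theta>\<close>. The space \<open>V\<close> is required to be nonzero: otherwise \<open>A\<close> would count as a central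
  extension of itself.
\<close>

definition central_extension ::
  "variety \<Rightarrow> ('f::field, 'v::ab_group_add) nalg \<Rightarrow> ('f \<Rightarrow> 'w::ab_group_add \<Rightarrow> 'w) \<Rightarrow>
     ('f, 'e::ab_group_add) nalg \<Rightarrow> bool" where
  "central_extension M A s E \<longleftrightarrow>
     algebra E \<and> in_variety M E \<and> vector_space s \<and> (\<exists>v::'w. v \<noteq> 0) \<and>
     (\<exists>\<theta>\<in>Z2 M A s. isomorphic E (ext A s \<theta>))"

definition nonsplit_central_extension_ann1 ::
  "variety \<Rightarrow> ('f::field, 'v::ab_group_add) nalg \<Rightarrow> ('f \<Rightarrow> 'w::ab_group_add \<Rightarrow> 'w) \<Rightarrow>
     ('f, 'e::ab_group_add) nalg \<Rightarrow> bool" where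
  "nonsplit_central_extension_ann1 M A s E \<longleftrightarrow>
     central_extension M A s E \<and> non_split E \<and> vector_space.dim (scl E) (Ann E) = 1"

text \<open>
  A vector \<open>\<Sum>\<^sub>i x\<^sub>i e\<^sub>i\<close> is the function \<open>i \<mapsto> x\<^sub>i\<close> with support in \<open>{1..n}\<close>. The
  definition of \<open>bvec n i\<close> includes the convention \<open>e\<^sub>m = 0\<close> for \<open>m > n\<close>.
\<close>

definition bvec :: "nat \<Rightarrow> nat \<Rightarrow> nat \<Rightarrow> 'f::field" where
  "bvec n i = (\<lambda>k. if k = i \<and> 1 \<le> i \<and> i \<le> n then 1 else 0)"

definition mu0 :: "nat \<Rightarrow> ('f::field, nat \<Rightarrow> 'f) nalg" where
  "mu0 n =
     \<lparr> carr = {x. \<forall>k. k \<notin> {1..n} \<longrightarrow> x k = 0},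
       scl = (\<lambda>c x k. c * x k),
       mul = (\<lambda>x y k. \<Sum>i=1..n. \<Sum>j=1..n. x i * y j * bvec n (i + j) k) \<rparr>"

definition Delta :: "nat \<Rightarrow> nat \<Rightarrow> nat \<Rightarrow> (nat \<Rightarrow> 'f::field) \<Rightarrow> (nat \<Rightarrow> 'f) \<Rightarrow> 'f" where
  "Delta n i j = on_carr (mu0 n) (\<lambda>x y. x i * y j)"

definition nabla :: "nat \<Rightarrow> nat \<Rightarrow> (nat \<Rightarrow> 'f::field) \<Rightarrow> (nat \<Rightarrow> 'f) \<Rightarrow> 'f" where
  "nabla n j = (\<Sum>k=1..j. Delta n k (j + 1 - k))"

definition LC_list :: "nat \<Rightarrow> ((nat \<Rightarrow> 'f::field) \<Rightarrow> (nat \<Rightarrow> 'f) \<Rightarrow> 'f) set" where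
  "LC_list n =
     {Delta n n 1} \<union> {nabla n n + bscale (*) \<mu> (Delta n n 1) | \<mu>. True} \<union>
     {nabla n n + Delta n i 1 | i. 2 \<le> i \<and> i \<le> n - 1}"

definition BC_list :: "nat \<Rightarrow> ((nat \<Rightarrow> 'f::field) \<Rightarrow> (nat \<Rightarrow> 'f) \<Rightarrow> 'f) set" where
  "BC_list n =
     (if n = 2 then {Delta 2 2 1} \<union> {nabla 2 2 + bscale (*) \<mu> (Delta 2 2 1) | \<mu>. True}
      else {nabla n n, nabla n n + Delta n 2 1})"

fun rep_list :: "variety \<Rightarrow> nat \<Rightarrow> ((nat \<Rightarrow> 'f::field) \<Rightarrow> (nat \<Rightarrow> 'f) \<Rightarrow> 'f) set" where
  "rep_list LC n = LC_list n"
| "rep_list BC n = BC_list n"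

lemma bvec_in_carr: "bvec n i \<in> carr (mu0 n)"
  by (auto simp: bvec_def mu0_def)

lemma carr_mu0_expand:
  assumes "x \<in> carr (mu0 n)"
  shows "x k = (\<Sum>i=1..n. x i * bvec n i k)"
proof -
  have "(\<Sum>i=1..n. x i * bvec n i k) = (\<Sum>i=1..n. if i = k then x k else 0)"
    by (rule sum.cong) (auto simp: bvec_def)
  also have "\<dots> = x k"
    using assms by (auto simp: mu0_def)
  finally show ?thesis by simp
qed

lemma mul_bvec:
  assumes "i \<in> {1..n}" "j \<in> {1..n}"
  shows "mul (mu0 n) (bvec n i) (bvec n j) = bvec n (i + j)"
proof
  fix k
  have "mul (mu0 n) (bvec n i) (bvec n j) k =
      (\<Sum>i'=1..n. \<Sum>j'=1..n. bvec n i i' * bvec n j j' * bvec n (i' + j') k)"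
    by (simp add: mu0_def)
  also have "\<dots> =
      (\<Sum>i'=1..n. \<Sum>j'=1..n. if j' = j then (if i' = i then bvec n (i + j) k else 0) else 0)"
    using assms by (intro sum.cong refl) (auto simp: bvec_def)
  also have "\<dots> = bvec n (i + j) k"
    using assms by simp
  finally show "mul (mu0 n) (bvec n i) (bvec n j) k = bvec n (i + j) k" .
qed

lemma Delta_bvec:
  assumes "i \<in> {1..n}" "j \<in> {1..n}" "l \<in> {1..n}" "m \<in> {1..n}"
  shows "Delta n i j (bvec n l) (bvec n m) = (if i = l \<and> j = m then 1 else 0)"
  using assms by (auto simp: Delta_def on_carr_def bvec_in_carr) (auto simp: bvec_def)

lemma algebra_mu0: "algebra (mu0 n)"
proof -
  have vs: "vector_space (scl (mu0 n :: ('a::field, nat \<Rightarrow> 'a) nalg))"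
    by unfold_locales (auto simp: mu0_def algebra_simps fun_eq_iff)
  interpret vector_space "scl (mu0 n :: ('a::field, nat \<Rightarrow> 'a) nalg)" by (rule vs)
  have "subspace (carr (mu0 n :: ('a, nat \<Rightarrow> 'a) nalg))"
    by (auto simp: subspace_def) (auto simp: mu0_def)
  moreover have "mul (mu0 n) x y \<in> carr (mu0 n)" for x y :: "nat \<Rightarrow> 'a"
    by (auto simp: mu0_def bvec_def intro!: sum.neutral)
  moreover have "bilinear_from (mu0 n) (scl (mu0 n :: ('a, nat \<Rightarrow> 'a) nalg)) (mul (mu0 n))"
    by (auto simp: bilinear_from_def linear_from_def mu0_def fun_eq_iff
        algebra_simps sum.distrib sum_distrib_left)
  ultimately show ?thesis
    using vs by (simp add: algebra_def)
qed

end

theory Submission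
  imports Defs "HOL-Computational_Algebra.Formal_Power_Series"
begin

text \<open>
  Think of \<open>mu0 n\<close> as $X F[X] / (X^{n+1})$ with $e_i = X^i$. Left commutativity of a cocycle
  \<open>\<theta>\<close> allows moving factors \<open>X\<close> from one argument to the other as long as the second
  argument keeps one: $\theta(e_i, e_j) = \theta(e_1, e_{i+j-1})$ whenever $j \ge 2$. So \<open>\<theta>\<close> is
  the sum of a form that only depends on $i + j$ and of a form $(x, y) \mapsto a(x) y_1$ with
  \<open>a\<close> linear. The coboundaries are the forms that depend on $i + j$ only and vanish for
  $i + j > n$. Therefore the class of \<open>\<theta>\<close> has the coordinates $t = \theta(e_1, e_n)$ and
  $a_i = \theta(e_i, e_1) - \theta(e_1, e_i)$ for $2 \le i \le n$ (\<open>lc_cocycle_coboundary\<close>);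
  they are the coefficients of \<open>nabla n n\<close> and of \<open>Delta n i 1\<close>. Right commutativity means
  $a_i = 0$ for $i \ge 3$ (\<open>BC_skew_coeff\<close>). The annihilator of the algebra is spanned by
  $e_n$, so it meets the annihilator of \<open>\<theta>\<close> trivially (call such a cocycle admissible) if and
  only if $t \ne 0$ or $a_n \ne 0$
  (\<open>Ann_cocycle_mu0_iff\<close>).

  An automorphism \<open>\<phi>\<close> is a substitution $X \mapsto c X + \dots$ with $c \ne 0$. It multiplies
  \<open>t\<close> by $c^{n+1}$ and turns the linear form \<open>a\<close> into $c (a \circ \phi)$
  (\<open>act_top_coeff\<close>, \<open>act_skew_coeff\<close>). Since \<open>\<phi>\<close> never lowers degrees, the last index
  \<open>m\<close> with $a_m \ne 0$ is an invariant of the orbit, and $a_m$ is multiplied by $c^{m+1}$. The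
  substitution $X \mapsto X + b X^{m+1-k}$ adds $k b a_m$ to $a_k$ and leaves the $a_l$ with
  $l > k$ alone; as \<open>k\<close> is invertible in characteristic 0, all $a_k$ with $k < m$ can be cleared,
  starting at $k = m - 1$ (\<open>clear_skew_coeff\<close>). What remains is \<open>t\<close> and $a_m$. Rescaling
  \<open>\<theta>\<close> and substituting $d X$ for \<open>X\<close> multiplies the ratio $a_m / t$ by $d^{m-n}$. If
  $m < n$, a root of suitable order makes the ratio 1; if $m = n$, the ratio is an invariant, and it
  is the parameter \<open>\<mu>\<close> of the family. This gives existence
  (\<open>exists_representative\<close>) and uniqueness (\<open>representatives_inequivalent\<close>) of the
  representatives.

  For an admissible \<open>\<theta>\<close> the annihilator of the extension is exactly the added line. An
  isomorphism of two such extensions preserves this line, hence induces an automorphism of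
  \<open>mu0 n\<close>, along which the cocycles match up to a scalar and a coboundary. So isomorphism
  classes of extensions correspond to orbits
  (\<open>isomorphic_ext_if_cocycle_equiv\<close>, \<open>cocycle_equiv_if_isomorphic_ext\<close>). Conversely an
  annihilator of dimension 1 forces the coefficient space to be a line
  (\<open>nonsplit_central_extension_cocycle\<close>).
\<close>

section \<open>Isomorphisms of algebras\<close>

lemma algebra_vs: "algebra A \<Longrightarrow> vector_space (scl A)"
  by (simp add: algebra_def)

lemma algebra_closed:
  assumes "algebra A"
  shows "0 \<in> carr A"
    and "x \<in> carr A \<Longrightarrow> y \<in> carr A \<Longrightarrow> x + y \<in> carr A"
    and "x \<in> carr A \<Longrightarrow> scl A c x \<in> carr A"
    and "x \<in> carr A \<Longrightarrow> y \<in> carr A \<Longrightarrow> mul A x y \<in> carr A"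
proof -
  interpret vector_space "scl A" using assms by (rule algebra_vs)
  have "subspace (carr A)" using assms by (simp add: algebra_def)
  then show "0 \<in> carr A" "x \<in> carr A \<Longrightarrow> y \<in> carr A \<Longrightarrow> x + y \<in> carr A"
      "x \<in> carr A \<Longrightarrow> scl A c x \<in> carr A"
    by (auto simp: subspace_def)
  show "x \<in> carr A \<Longrightarrow> y \<in> carr A \<Longrightarrow> mul A x y \<in> carr A"
    using assms by (auto simp: algebra_def)
qed

lemma linear_fromD:
  assumes "linear_from A s f"
  shows "x \<in> carr A \<Longrightarrow> y \<in> carr A \<Longrightarrow> f (x + y) = f x + f y"
    and "x \<in> carr A \<Longrightarrow> f (scl A c x) = s c (f x)"
  using assms by (auto simp: linear_from_def)

lemma linear_from_zero:
  assumes "algebra A" "linear_from A s f"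
  shows "f 0 = 0"
  using linear_fromD(1)[OF assms(2), of 0 0] algebra_closed(1)[OF assms(1)] by simp

lemma bilinear_fromD:
  assumes "bilinear_from A s \<theta>" "x \<in> carr A"
  shows "y \<in> carr A \<Longrightarrow> z \<in> carr A \<Longrightarrow> \<theta> x (y + z) = \<theta> x y + \<theta> x z"
    and "y \<in> carr A \<Longrightarrow> z \<in> carr A \<Longrightarrow> \<theta> (y + z) x = \<theta> y x + \<theta> z x"
    and "y \<in> carr A \<Longrightarrow> \<theta> x (scl A c y) = s c (\<theta> x y)"
    and "y \<in> carr A \<Longrightarrow> \<theta> (scl A c y) x = s c (\<theta> y x)"
  using assms by (auto simp: bilinear_from_def linear_from_def)

lemma bilinear_from_zero:
  assumes "algebra A" "bilinear_from A s \<theta>" "x \<in> carr A"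
  shows "\<theta> x 0 = 0" "\<theta> 0 x = 0"
  using linear_from_zero[OF assms(1)] assms by (auto simp: bilinear_from_def)

lemma isomorphismD:
  assumes "isomorphism A B \<phi>"
  shows "bij_betw \<phi> (carr A) (carr B)"
    and "linear_from A (scl B) \<phi>"
    and "x \<in> carr A \<Longrightarrow> \<phi> x \<in> carr B"
    and "x \<in> carr A \<Longrightarrow> y \<in> carr A \<Longrightarrow> \<phi> (mul A x y) = mul B (\<phi> x) (\<phi> y)"
  using assms by (auto simp: isomorphism_def bij_betw_apply)

lemma isomorphism_comp:
  assumes "isomorphism A B \<phi>" "isomorphism B C \<psi>"
  shows "isomorphism A C (\<psi> \<circ> \<phi>)"
  using assms isomorphismD(3)[OF assms(1)]
  by (auto simp: isomorphism_def linear_from_def intro: bij_betw_trans)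

lemma isomorphism_inv_into:
  assumes "algebra A" "isomorphism A B \<phi>"
  shows "isomorphism B A (inv_into (carr A) \<phi>)"
proof -
  let ?\<psi> = "inv_into (carr A) \<phi>"
  note bij = isomorphismD(1)[OF assms(2)] and lin = linear_fromD[OF isomorphismD(2)[OF assms(2)]]
  note cl = algebra_closed[OF assms(1)]
  have left: "?\<psi> (\<phi> x) = x" if "x \<in> carr A" for x
    using bij that by (rule bij_betw_inv_into_left)
  have preimage: "\<exists>a\<in>carr A. x = \<phi> a" if "x \<in> carr B" for x
    using bij that by (auto simp: bij_betw_def)
  have "?\<psi> (x + y) = ?\<psi> x + ?\<psi> y" "?\<psi> (mul B x y) = mul A (?\<psi> x) (?\<psi> y)"
    if x: "x \<in> carr B" and y: "y \<in> carr B" for x y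
  proof -
    obtain a b where ab: "a \<in> carr A" "b \<in> carr A" "x = \<phi> a" "y = \<phi> b"
      using preimage[OF x] preimage[OF y] by auto
    have "x + y = \<phi> (a + b)" using ab lin by simp
    then show "?\<psi> (x + y) = ?\<psi> x + ?\<psi> y" using ab cl by (simp add: left)
    have "mul B x y = \<phi> (mul A a b)" using ab isomorphismD(4)[OF assms(2)] by simp
    then show "?\<psi> (mul B x y) = mul A (?\<psi> x) (?\<psi> y)" using ab cl by (simp add: left)
  qed
  moreover have "?\<psi> (scl B c x) = scl A c (?\<psi> x)" if x: "x \<in> carr B" for c x
  proof -
    obtain a where a: "a \<in> carr A" "x = \<phi> a" using preimage[OF x] by auto
    then have "scl B c x = \<phi> (scl A c a)" using lin by simp
    then show ?thesis using a cl by (simp add: left)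
  qed
  ultimately show ?thesis
    using bij_betw_inv_into[OF bij] by (simp add: isomorphism_def linear_from_def)
qed

lemma isomorphic_trans: "isomorphic A B \<Longrightarrow> isomorphic B C \<Longrightarrow> isomorphic A C"
  unfolding isomorphic_def using isomorphism_comp by blast

lemma isomorphic_refl: "isomorphic A A"
  unfolding isomorphic_def
  by (rule exI[of _ id]) (simp add: isomorphism_def linear_from_def)

lemma isomorphism_image_Ann_subset:
  assumes "algebra A" "isomorphism A B \<phi>"
  shows "\<phi> ` Ann A \<subseteq> Ann B"
proof
  fix z assume "z \<in> \<phi> ` Ann A"
  then obtain x where x: "x \<in> Ann A" "z = \<phi> x" by auto
  have zero: "\<phi> 0 = 0" using assms isomorphismD(2) linear_from_zero by blast
  have "mul B z (\<phi> a) = 0 \<and> mul B (\<phi> a) z = 0" if a: "a \<in> carr A" for a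
    using x a zero isomorphismD(4)[OF assms(2), of x a] isomorphismD(4)[OF assms(2), of a x]
    by (auto simp: Ann_def)
  moreover have "carr B = \<phi> ` carr A"
    using isomorphismD(1)[OF assms(2)] by (simp add: bij_betw_def)
  moreover have "x \<in> carr A" using x by (simp add: Ann_def)
  ultimately show "z \<in> Ann B" using x by (auto simp: Ann_def)
qed

lemma isomorphism_image_Ann:
  assumes "algebra A" "algebra B" "isomorphism A B \<phi>"
  shows "\<phi> ` Ann A = Ann B"
proof -
  let ?\<psi> = "inv_into (carr A) \<phi>"
  have "?\<psi> ` Ann B \<subseteq> Ann A"
    by (rule isomorphism_image_Ann_subset[OF assms(2) isomorphism_inv_into[OF assms(1,3)]])
  moreover have "\<phi> (?\<psi> z) = z" if "z \<in> Ann B" for z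
    using that isomorphismD(1)[OF assms(3)]
    by (auto simp: Ann_def bij_betw_inv_into_right)
  ultimately have "Ann B \<subseteq> \<phi> ` Ann A" by force
  then show ?thesis using isomorphism_image_Ann_subset[OF assms(1,3)] by auto
qed

section \<open>Orbits of lines of cohomology classes\<close>

text \<open>
  The relation between \<open>\<theta>\<close> and \<open>\<theta>'\<close> that describes orbits of lines pointwise: up to a
  nonzero scalar and a coboundary, \<open>\<theta>'\<close> is the pull-back of \<open>\<theta>\<close> along an automorphism. Stated this
  way, it can be tested on values, without passing to classes.
\<close>

definition cocycle_equiv ::
  "('f::field, 'v::ab_group_add) nalg \<Rightarrow> ('v \<Rightarrow> 'v \<Rightarrow> 'f) \<Rightarrow> ('v \<Rightarrow> 'v \<Rightarrow> 'f) \<Rightarrow> bool" where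
  "cocycle_equiv A \<theta> \<theta>' \<longleftrightarrow>
     (\<exists>\<phi>\<in>Aut A. \<exists>c f. c \<noteq> 0 \<and> linear_from A (*) f \<and>
        (\<forall>x\<in>carr A. \<forall>y\<in>carr A. \<theta>' x y = c * \<theta> (\<phi> x) (\<phi> y) + f (mul A x y)))"

lemma AutD:
  assumes "\<phi> \<in> Aut A"
  shows "x \<in> carr A \<Longrightarrow> \<phi> x \<in> carr A"
    and "x \<in> carr A \<Longrightarrow> y \<in> carr A \<Longrightarrow> \<phi> (mul A x y) = mul A (\<phi> x) (\<phi> y)"
    and "x \<in> carr A \<Longrightarrow> y \<in> carr A \<Longrightarrow> \<phi> (x + y) = \<phi> x + \<phi> y"
    and "x \<in> carr A \<Longrightarrow> \<phi> (scl A c x) = scl A c (\<phi> x)"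
  using assms isomorphismD(2-4)[of A A \<phi>] linear_fromD[of A "scl A" \<phi>] by (auto simp: Aut_def)

lemma linear_from_comp_Aut:
  assumes "\<phi> \<in> Aut A" "linear_from A s f"
  shows "linear_from A s (\<lambda>x. f (\<phi> x))"
  using assms(2) AutD[OF assms(1)] by (simp add: linear_from_def)

lemma cocycle_equiv_sym:
  assumes A: "algebra A" and eq: "cocycle_equiv A \<theta> \<theta>'"
  shows "cocycle_equiv A \<theta>' \<theta>"
proof -
  obtain \<phi> c f where \<phi>: "\<phi> \<in> Aut A" and c: "c \<noteq> 0" and f: "linear_from A (*) f"
    and \<theta>': "\<And>x y. x \<in> carr A \<Longrightarrow> y \<in> carr A \<Longrightarrow> \<theta>' x y = c * \<theta> (\<phi> x) (\<phi> y) + f (mul A x y)"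
    using eq by (auto simp: cocycle_equiv_def)
  define \<psi> where "\<psi> = inv_into (carr A) \<phi>"
  have \<psi>: "\<psi> \<in> Aut A" using isomorphism_inv_into[OF A] \<phi> by (simp add: Aut_def \<psi>_def)
  have right: "\<phi> (\<psi> x) = x" if "x \<in> carr A" for x
    using that isomorphismD(1)[of A A \<phi>] \<phi> by (auto simp: \<psi>_def Aut_def bij_betw_inv_into_right)
  define g where "g = (\<lambda>x. - (f (\<psi> x)) / c)"
  have "linear_from A (*) g"
    using linear_from_comp_Aut[OF \<psi> f]
    by (auto simp: g_def linear_from_def add_divide_distrib diff_divide_distrib)
  moreover have "\<theta> x y = (1 / c) * \<theta>' (\<psi> x) (\<psi> y) + g (mul A x y)"
    if "x \<in> carr A" "y \<in> carr A" for x y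
    using that c \<theta>'[OF AutD(1)[OF \<psi>] AutD(1)[OF \<psi>], of x y] AutD(2)[OF \<psi>, of x y]
    by (simp add: right g_def field_simps)
  ultimately show ?thesis
    using \<psi> c unfolding cocycle_equiv_def by (intro bexI[of _ \<psi>] exI[of _ "1/c"] exI[of _ g]) auto
qed

lemma cocycle_equiv_trans:
  assumes "cocycle_equiv A \<theta> \<theta>'" "cocycle_equiv A \<theta>' \<theta>''" "algebra A"
  shows "cocycle_equiv A \<theta> \<theta>''"
proof -
  obtain \<phi> c f where \<phi>: "\<phi> \<in> Aut A" and c: "c \<noteq> 0" and f: "linear_from A (*) f"
    and \<theta>': "\<And>x y. x \<in> carr A \<Longrightarrow> y \<in> carr A \<Longrightarrow> \<theta>' x y = c * \<theta> (\<phi> x) (\<phi> y) + f (mul A x y)"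
    using assms(1) by (auto simp: cocycle_equiv_def)
  obtain \<psi> d g where \<psi>: "\<psi> \<in> Aut A" and d: "d \<noteq> 0" and g: "linear_from A (*) g"
    and \<theta>'': "\<And>x y. x \<in> carr A \<Longrightarrow> y \<in> carr A \<Longrightarrow> \<theta>'' x y = d * \<theta>' (\<psi> x) (\<psi> y) + g (mul A x y)"
    using assms(2) by (auto simp: cocycle_equiv_def)
  define h where "h = (\<lambda>x. d * f (\<psi> x) + g x)"
  have "linear_from A (*) h"
    using linear_from_comp_Aut[OF \<psi> f] g by (auto simp: h_def linear_from_def algebra_simps)
  moreover have "\<phi> \<circ> \<psi> \<in> Aut A" using \<phi> \<psi> isomorphism_comp by (auto simp: Aut_def)
  moreover have "\<theta>'' x y = (d * c) * \<theta> ((\<phi> \<circ> \<psi>) x) ((\<phi> \<circ> \<psi>) y) + h (mul A x y)"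
    if "x \<in> carr A" "y \<in> carr A" for x y
    using that \<theta>''[of x y] \<theta>'[of "\<psi> x" "\<psi> y"] AutD(1,2)[OF \<psi>]
    by (simp add: h_def algebra_simps)
  ultimately show ?thesis
    using c d unfolding cocycle_equiv_def
    by (intro bexI[of _ "\<phi> \<circ> \<psi>"] exI[of _ "d * c"] exI[of _ h]) auto
qed

lemma B2_closed:
  shows "0 \<in> B2 A (*)"
    and "\<beta> \<in> B2 A (*) \<Longrightarrow> \<gamma> \<in> B2 A (*) \<Longrightarrow> \<beta> + \<gamma> \<in> B2 A (*)"
    and "\<beta> \<in> B2 A (*) \<Longrightarrow> bscale (*) c \<beta> \<in> B2 A (*)"
    and "\<beta> \<in> B2 A (*) \<Longrightarrow> - \<beta> \<in> B2 A (*)"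
proof -
  show "0 \<in> B2 A (*)"
    unfolding B2_def
    by (rule CollectI, rule exI[of _ "\<lambda>_. 0"]) (auto simp: linear_from_def on_carr_def fun_eq_iff)
  show "\<beta> + \<gamma> \<in> B2 A (*)" if \<beta>\<gamma>: "\<beta> \<in> B2 A (*)" "\<gamma> \<in> B2 A (*)"
  proof -
    obtain f g where fg: "linear_from A (*) f" "linear_from A (*) g"
      "\<beta> = on_carr A (\<lambda>x y. f (mul A x y))" "\<gamma> = on_carr A (\<lambda>x y. g (mul A x y))"
      using \<beta>\<gamma> unfolding B2_def by blast
    show ?thesis unfolding B2_def
      by (rule CollectI, rule exI[of _ "\<lambda>x. f x + g x"])
        (use fg in \<open>auto simp: linear_from_def on_carr_def fun_eq_iff algebra_simps\<close>)
  qed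
  show scale: "bscale (*) c \<beta> \<in> B2 A (*)" if \<beta>: "\<beta> \<in> B2 A (*)" for c \<beta>
  proof -
    obtain f where f: "linear_from A (*) f" "\<beta> = on_carr A (\<lambda>x y. f (mul A x y))"
      using \<beta> by (auto simp: B2_def)
    show ?thesis unfolding B2_def
      by (rule CollectI, rule exI[of _ "\<lambda>x. c * f x"])
        (use f in \<open>auto simp: linear_from_def on_carr_def bscale_def fun_eq_iff algebra_simps\<close>)
  qed
  show "- \<beta> \<in> B2 A (*)" if "\<beta> \<in> B2 A (*)"
    using scale[OF that, of "-1"] by (simp add: bscale_def fun_Compl_def)
qed

text \<open>
  The pull-back of the coboundary of \<open>f\<close> is the coboundary of \<open>f \<circ> \<phi>\<close>.
\<close>

lemma act_B2:
  assumes "algebra A" "\<phi> \<in> Aut A" "\<beta> \<in> B2 A (*)"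
  shows "act A \<phi> \<beta> \<in> B2 A (*)"
proof -
  obtain f where f: "linear_from A (*) f" "\<beta> = on_carr A (\<lambda>x y. f (mul A x y))"
    using assms(3) by (auto simp: B2_def)
  show ?thesis unfolding B2_def
    by (rule CollectI, rule exI[of _ "\<lambda>x. f (\<phi> x)"])
      (use f AutD[OF assms(2)] linear_from_comp_Aut[OF assms(2) f(1)]
        in \<open>auto simp: on_carr_def act_def fun_eq_iff\<close>)
qed

lemma cls_add_B2:
  assumes "\<beta> \<in> B2 A (*)"
  shows "cls A (*) (\<theta> + \<beta>) = cls A (*) \<theta>"
proof -
  have sub: "cls A (*) (\<theta> + \<beta>) \<subseteq> cls A (*) \<theta>" if "\<beta> \<in> B2 A (*)" for \<theta> \<beta>
    using B2_closed(2)[OF that] by (auto simp: cls_def add.assoc)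
  from sub[OF B2_closed(4)[OF assms], of "\<theta> + \<beta>"] have "cls A (*) \<theta> \<subseteq> cls A (*) (\<theta> + \<beta>)"
    by (simp add: add.assoc)
  with sub[OF assms] show ?thesis by blast
qed

lemma self_in_cls: "\<theta> \<in> cls A (*) \<theta>"
  using B2_closed(1)[of A] by (auto simp: cls_def intro!: exI[of _ 0])

lemma cls_eq_iff: "cls A (*) \<theta>' = cls A (*) \<theta> \<longleftrightarrow> \<theta>' \<in> cls A (*) \<theta>"
proof
  show "\<theta>' \<in> cls A (*) \<theta>" if "cls A (*) \<theta>' = cls A (*) \<theta>"
    using that self_in_cls[of \<theta>'] by blast
  show "cls A (*) \<theta>' = cls A (*) \<theta>" if mem: "\<theta>' \<in> cls A (*) \<theta>"
  proof -
    obtain \<beta> where "\<beta> \<in> B2 A (*)" "\<theta>' = \<theta> + \<beta>"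
      using mem unfolding cls_def by blast
    then show ?thesis using cls_add_B2 by blast
  qed
qed

lemma cls_eq_B2_iff: "cls A (*) \<theta> = B2 A (*) \<longleftrightarrow> \<theta> \<in> B2 A (*)"
  using cls_eq_iff[of A \<theta> 0] by (simp add: cls_def[of A "(*)" 0])

lemma H2_scale_cls: "H2_scale A (*) c (cls A (*) \<theta>) = cls A (*) (bscale (*) c \<theta>)"
proof -
  have "cls A (*) (bscale (*) c \<eta>) = cls A (*) (bscale (*) c \<theta>)" if \<eta>: "\<eta> \<in> cls A (*) \<theta>" for \<eta>
  proof -
    obtain \<beta> where "\<beta> \<in> B2 A (*)" "\<eta> = \<theta> + \<beta>" using \<eta> by (auto simp: cls_def)
    moreover have "bscale (*) c (\<theta> + \<beta>) = bscale (*) c \<theta> + bscale (*) c \<beta>"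
      by (simp add: bscale_def fun_eq_iff algebra_simps)
    ultimately show ?thesis using cls_add_B2 B2_closed(3) by metis
  qed
  then show ?thesis using self_in_cls unfolding H2_scale_def by blast
qed

lemma H2_act_cls:
  assumes "algebra A" "\<phi> \<in> Aut A"
  shows "H2_act A (*) \<phi> (cls A (*) \<theta>) = cls A (*) (act A \<phi> \<theta>)"
proof -
  have "cls A (*) (act A \<phi> \<eta>) = cls A (*) (act A \<phi> \<theta>)" if \<eta>: "\<eta> \<in> cls A (*) \<theta>" for \<eta>
  proof -
    obtain \<beta> where "\<beta> \<in> B2 A (*)" "\<eta> = \<theta> + \<beta>" using \<eta> by (auto simp: cls_def)
    moreover have "act A \<phi> (\<theta> + \<beta>) = act A \<phi> \<theta> + act A \<phi> \<beta>"
      by (simp add: act_def on_carr_def fun_eq_iff)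
    ultimately show ?thesis using cls_add_B2 act_B2[OF assms] by metis
  qed
  then show ?thesis using self_in_cls unfolding H2_act_def by blast
qed

lemma cocycle_line_eq: "cocycle_line A \<theta> = range (\<lambda>c. cls A (*) (bscale (*) c \<theta>))"
  by (simp add: cocycle_line_def H2_line_def H2_scale_cls)

lemma H2_act_cocycle_line:
  assumes "algebra A" "\<phi> \<in> Aut A"
  shows "H2_act A (*) \<phi> ` cocycle_line A \<theta> = cocycle_line A (act A \<phi> \<theta>)"
proof -
  have "act A \<phi> (bscale (*) c \<theta>) = bscale (*) c (act A \<phi> \<theta>)" for c
    by (simp add: act_def bscale_def on_carr_def fun_eq_iff)
  then show ?thesis by (simp add: cocycle_line_eq image_image H2_act_cls[OF assms])
qed

text \<open>
  The class of \<open>\<theta>'\<close> lies on its own line, so equality of the lines makes it a multiple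
  of the class of \<open>\<theta>\<close>; the factor cannot be 0 because \<open>\<theta>'\<close> is not a coboundary.
\<close>

lemma cocycle_line_eq_iff:
  assumes "\<theta>' \<notin> B2 A (*)"
  shows "cocycle_line A \<theta>' = cocycle_line A \<theta> \<longleftrightarrow> (\<exists>c. c \<noteq> 0 \<and> \<theta>' \<in> cls A (*) (bscale (*) c \<theta>))"
proof
  assume eq: "cocycle_line A \<theta>' = cocycle_line A \<theta>"
  have one: "bscale (*) 1 \<theta>' = \<theta>'" by (simp add: bscale_def)
  have "cls A (*) \<theta>' \<in> cocycle_line A \<theta>'"
    unfolding cocycle_line_eq using one by (metis rangeI)
  then obtain c where c: "cls A (*) \<theta>' = cls A (*) (bscale (*) c \<theta>)"
    using eq by (auto simp: cocycle_line_eq)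
  moreover have "c \<noteq> 0"
  proof
    assume "c = 0"
    then have "bscale (*) c \<theta> = 0" by (simp add: bscale_def fun_eq_iff)
    then have "cls A (*) (bscale (*) c \<theta>) = B2 A (*)" by (simp add: cls_def)
    then show False using c assms cls_eq_B2_iff by metis
  qed
  ultimately show "\<exists>c. c \<noteq> 0 \<and> \<theta>' \<in> cls A (*) (bscale (*) c \<theta>)" using cls_eq_iff by metis
next
  assume "\<exists>c. c \<noteq> 0 \<and> \<theta>' \<in> cls A (*) (bscale (*) c \<theta>)"
  then obtain c where c: "c \<noteq> 0" "cls A (*) \<theta>' = cls A (*) (bscale (*) c \<theta>)"
    using cls_eq_iff by metis
  have mult: "cls A (*) (bscale (*) d \<theta>') = cls A (*) (bscale (*) (d * c) \<theta>)" for d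
  proof -
    have "cls A (*) (bscale (*) d \<theta>') = H2_scale A (*) d (cls A (*) (bscale (*) c \<theta>))"
      using c H2_scale_cls by metis
    also have "\<dots> = cls A (*) (bscale (*) (d * c) \<theta>)"
      by (simp add: H2_scale_cls bscale_def mult.assoc)
    finally show ?thesis .
  qed
  have "cls A (*) (bscale (*) d \<theta>) = cls A (*) (bscale (*) (d / c) \<theta>')" for d
    using mult[of "d / c"] c by simp
  then show "cocycle_line A \<theta>' = cocycle_line A \<theta>"
    unfolding cocycle_line_eq using mult by blast
qed

text \<open>
  Reduces all questions about orbits of lines to \<open>cocycle_equiv\<close>.
\<close>

lemma cocycle_line_in_orbit_iff:
  assumes "algebra A" "on_carr A \<theta>' = \<theta>'" "\<theta>' \<notin> B2 A (*)"
  shows "cocycle_line A \<theta>' \<in> orbit A (cocycle_line A \<theta>) \<longleftrightarrow> cocycle_equiv A \<theta> \<theta>'"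
proof -
  have *: "\<theta>' \<in> cls A (*) (bscale (*) c (act A \<phi> \<theta>)) \<longleftrightarrow>
     (\<exists>f. linear_from A (*) f \<and>
        (\<forall>x\<in>carr A. \<forall>y\<in>carr A. \<theta>' x y = c * \<theta> (\<phi> x) (\<phi> y) + f (mul A x y)))" for c \<phi>
  proof -
    have "\<theta>' = bscale (*) c (act A \<phi> \<theta>) + on_carr A (\<lambda>x y. f (mul A x y)) \<longleftrightarrow>
      (\<forall>x\<in>carr A. \<forall>y\<in>carr A. \<theta>' x y = c * \<theta> (\<phi> x) (\<phi> y) + f (mul A x y))" for f
      by (subst assms(2)[symmetric]) (auto simp: on_carr_def bscale_def act_def fun_eq_iff)
    then show ?thesis by (auto simp: cls_def B2_def)
  qed
  have "orbit A (cocycle_line A \<theta>) = (\<lambda>\<phi>. cocycle_line A (act A \<phi> \<theta>)) ` Aut A"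
    unfolding orbit_def Setcompr_eq_image
    by (intro image_cong) (simp_all add: H2_act_cocycle_line[OF assms(1)])
  then have "cocycle_line A \<theta>' \<in> orbit A (cocycle_line A \<theta>) \<longleftrightarrow>
    (\<exists>\<phi>\<in>Aut A. cocycle_line A \<theta>' = cocycle_line A (act A \<phi> \<theta>))"
    by (simp add: image_iff)
  also have "\<dots> \<longleftrightarrow> cocycle_equiv A \<theta> \<theta>'"
    unfolding cocycle_line_eq_iff[OF assms(3)] * cocycle_equiv_def by simp
  finally show ?thesis .
qed

section \<open>Central extensions\<close>

lemma vector_space_field: "vector_space ((*) :: 'f::field \<Rightarrow> 'f \<Rightarrow> 'f)"
  by unfold_locales (simp_all add: algebra_simps)

lemma Z2_in_LC: "\<theta> \<in> Z2 M A s \<Longrightarrow> \<theta> \<in> Z2_LC A s"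
  by (cases M) (auto simp: Z2_BC_def)

lemma Z2_LC_D:
  assumes "\<theta> \<in> Z2_LC A s"
  shows "bilinear_from A s \<theta>" "on_carr A \<theta> = \<theta>"
    and "x \<in> carr A \<Longrightarrow> y \<in> carr A \<Longrightarrow> z \<in> carr A \<Longrightarrow> \<theta> x (mul A y z) = \<theta> y (mul A x z)"
  using assms by (simp_all add: Z2_LC_def Bil_def)

lemma ext_simps [simp]:
  "carr (ext A s \<theta>) = carr A \<times> UNIV"
  "scl (ext A s \<theta>) c p = (scl A c (fst p), s c (snd p))"
  "mul (ext A s \<theta>) p q = (mul A (fst p) (fst q), \<theta> (fst p) (fst q))"
  by (auto simp: ext_def split_beta)

lemma vector_space_ext:
  assumes "algebra A" "vector_space s"
  shows "vector_space (scl (ext A s \<theta>))"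
proof -
  interpret a: vector_space "scl A" using assms(1) by (rule algebra_vs)
  interpret s: vector_space s by fact
  show ?thesis
    by unfold_locales
      (auto simp: a.scale_right_distrib a.scale_left_distrib s.scale_right_distrib s.scale_left_distrib)
qed

lemma algebra_ext:
  assumes A: "algebra A" and s: "vector_space s" and \<theta>: "bilinear_from A s \<theta>"
  shows "algebra (ext A s \<theta>)"
proof -
  have vs: "vector_space (scl (ext A s \<theta>))" using A s by (rule vector_space_ext)
  interpret e: vector_space "scl (ext A s \<theta>)" by (rule vs)
  note cl = algebra_closed[OF A]
  have m: "bilinear_from A (scl A) (mul A)" using A by (simp add: algebra_def)
  have "e.subspace (carr (ext A s \<theta>))"
    using cl by (auto simp: e.subspace_def mem_Times_iff)
  moreover have "bilinear_from (ext A s \<theta>) (scl (ext A s \<theta>)) (mul (ext A s \<theta>))"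
    using bilinear_fromD[OF \<theta>] bilinear_fromD[OF m]
    by (auto simp: bilinear_from_def[of "ext A s \<theta>"] linear_from_def[of "ext A s \<theta>"])
  ultimately show ?thesis
    using vs cl by (auto simp: algebra_def[of "ext A s \<theta>"])
qed

lemma in_variety_ext:
  assumes "in_variety M A" "\<theta> \<in> Z2 M A s"
  shows "in_variety M (ext A s \<theta>)"
proof (cases M)
  case LC
  then show ?thesis using assms
    by (auto simp: left_commutative_def Z2_LC_def)
next
  case BC
  then show ?thesis using assms
    by (auto simp: left_commutative_def right_commutative_def Z2_LC_def Z2_BC_def)
qed

lemma Ann_ext: "Ann (ext A s \<theta>) = (Ann_cocycle A \<theta> \<inter> Ann A) \<times> UNIV"
  by (auto simp: Ann_def Ann_cocycle_def zero_prod_def)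

text \<open>
  If $\theta' = c (\phi \cdot \theta) + \delta f$, the coboundary is absorbed by the shear
  $v \mapsto v - f(x)$ of the coefficient line and the scalar by its rescaling.
\<close>

lemma isomorphic_ext_if_cocycle_equiv:
  assumes A: "algebra A" and eq: "cocycle_equiv A \<theta> \<theta>'"
  shows "isomorphic (ext A (*) \<theta>') (ext A (*) \<theta>)"
proof -
  obtain \<phi> c f where \<phi>: "\<phi> \<in> Aut A" and c: "c \<noteq> 0" and f: "linear_from A (*) f"
    and \<theta>': "\<And>x y. x \<in> carr A \<Longrightarrow> y \<in> carr A \<Longrightarrow> \<theta>' x y = c * \<theta> (\<phi> x) (\<phi> y) + f (mul A x y)"
    using eq by (auto simp: cocycle_equiv_def)
  have bij: "bij_betw \<phi> (carr A) (carr A)" using \<phi> by (simp add: Aut_def isomorphism_def)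
  define \<Psi> where "\<Psi> = (\<lambda>(x, v). (\<phi> x, (v - f x) / c))"
  have "bij_betw \<Psi> (carr A \<times> UNIV) (carr A \<times> UNIV)"
  proof (rule bij_betwI')
    show "(\<Psi> p = \<Psi> q) = (p = q)" if "p \<in> carr A \<times> UNIV" "q \<in> carr A \<times> UNIV" for p q
      using that bij c by (auto simp: \<Psi>_def bij_betw_def inj_on_def)
    show "\<Psi> p \<in> carr A \<times> UNIV" if "p \<in> carr A \<times> UNIV" for p
      using that AutD(1)[OF \<phi>] by (auto simp: \<Psi>_def)
    show "\<exists>p\<in>carr A \<times> UNIV. q = \<Psi> p" if "q \<in> carr A \<times> UNIV" for q
    proof -
      have "fst q \<in> \<phi> ` carr A" using that bij by (auto simp: bij_betw_def)
      then obtain x where "x \<in> carr A" "fst q = \<phi> x" by auto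
      then show ?thesis
        using c by (intro bexI[of _ "(x, c * snd q + f x)"]) (auto simp: \<Psi>_def prod_eq_iff)
    qed
  qed
  moreover have "linear_from (ext A (*) \<theta>') (scl (ext A (*) \<theta>)) \<Psi>"
    using linear_fromD[OF f] AutD(3,4)[OF \<phi>] c
    by (auto simp: linear_from_def[of "ext A (*) \<theta>'"] \<Psi>_def field_simps)
  moreover have "\<Psi> (mul (ext A (*) \<theta>') p q) = mul (ext A (*) \<theta>) (\<Psi> p) (\<Psi> q)"
    if "p \<in> carr A \<times> UNIV" "q \<in> carr A \<times> UNIV" for p q
    using that \<theta>' AutD(2)[OF \<phi>] c by (auto simp: \<Psi>_def)
  ultimately show ?thesis unfolding isomorphic_def isomorphism_def by auto
qed

text \<open>
  Under the two hypotheses on annihilators, the coefficient line is the annihilator of both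
  extensions, so an isomorphism preserves it and has the form
  $(x, v) \mapsto (\phi(x), g(x) + l v)$. Comparing the second components of products gives
  $\theta'(\phi(x), \phi(y)) = g(xy) + l \theta(x, y)$.
\<close>

lemma cocycle_equiv_if_isomorphic_ext:
  assumes A: "algebra A"
    and bil: "bilinear_from A (*) \<theta>" "bilinear_from A (*) \<theta>'"
    and ann: "Ann_cocycle A \<theta> \<inter> Ann A = {0}" "Ann_cocycle A \<theta>' \<inter> Ann A = {0}"
    and iso: "isomorphic (ext A (*) \<theta>) (ext A (*) \<theta>')"
  shows "cocycle_equiv A \<theta>' \<theta>"
proof -
  obtain \<Psi> where \<Psi>: "isomorphism (ext A (*) \<theta>) (ext A (*) \<theta>') \<Psi>"
    using iso by (auto simp: isomorphic_def)
  note cl = algebra_closed[OF A]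
  have lin: "\<Psi> (p + q) = \<Psi> p + \<Psi> q" "\<Psi> (scl A c (fst p), c * snd p) = (scl A c (fst (\<Psi> p)), c * snd (\<Psi> p))"
    if "fst p \<in> carr A" "fst q \<in> carr A" for p q c
    using that linear_fromD[OF isomorphismD(2)[OF \<Psi>]] by (auto simp: mem_Times_iff)
  have inj: "p = q" if "\<Psi> p = \<Psi> q" "fst p \<in> carr A" "fst q \<in> carr A" for p q
    using inj_onD[of \<Psi> "carr A \<times> UNIV" p q] isomorphismD(1)[OF \<Psi>] that
    by (auto simp: bij_betw_def mem_Times_iff)
  interpret a: vector_space "scl A" using A by (rule algebra_vs)
  have image_V: "\<Psi> ` ({0} \<times> UNIV) = {0} \<times> UNIV"
    using isomorphism_image_Ann[OF algebra_ext[OF A vector_space_field bil(1)]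
        algebra_ext[OF A vector_space_field bil(2)] \<Psi>] ann
    by (simp add: Ann_ext)
  have V: "fst (\<Psi> (0, v)) = 0" for v
  proof -
    have "\<Psi> (0, v) \<in> \<Psi> ` ({0} \<times> UNIV)" by simp
    then show ?thesis unfolding image_V by auto
  qed
  define l where "l = snd (\<Psi> (0, 1))"
  have \<Psi>_V: "\<Psi> (0, v) = (0, v * l)" for v
    using lin(2)[of "(0, 1)" "(0, 1)" v] V cl by (simp add: l_def prod_eq_iff)
  have l: "l \<noteq> 0"
  proof
    assume "l = 0"
    then have "\<Psi> (0, 1) = \<Psi> (0, 0)" by (simp add: \<Psi>_V)
    then show False using inj[of "(0, 1)" "(0, 0)"] cl(1) by simp
  qed
  define \<phi> g where "\<phi> = (\<lambda>x. fst (\<Psi> (x, 0)))" and "g = (\<lambda>x. snd (\<Psi> (x, 0)))"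
  have split: "\<Psi> (x, v) = (\<phi> x, g x + v * l)" if "x \<in> carr A" for x v
    using lin(1)[of "(x, 0)" "(0, v)"] that cl by (simp add: \<phi>_def g_def \<Psi>_V prod_eq_iff)
  have \<phi>_carr: "\<phi> x \<in> carr A" if "x \<in> carr A" for x
    using isomorphismD(3)[OF \<Psi>, of "(x, 0)"] that by (auto simp: \<phi>_def mem_Times_iff)
  have mult: "\<phi> (mul A x y) = mul A (\<phi> x) (\<phi> y) \<and> g (mul A x y) + \<theta> x y * l = \<theta>' (\<phi> x) (\<phi> y)"
    if "x \<in> carr A" "y \<in> carr A" for x y
    using isomorphismD(4)[OF \<Psi>, of "(x, 0)" "(y, 0)"] that cl by (simp add: split)
  have linear: "\<phi> (x + y) = \<phi> x + \<phi> y" "g (x + y) = g x + g y"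
    "\<phi> (scl A c x) = scl A c (\<phi> x)" "g (scl A c x) = c * g x"
    if "x \<in> carr A" "y \<in> carr A" for x y c
    using lin(1)[of "(x, 0)" "(y, 0)"] lin(2)[of "(x, 0)" "(y, 0)" c] that cl
    by (auto simp: split)
  have "bij_betw \<phi> (carr A) (carr A)"
  proof (rule bij_betwI')
    show "(\<phi> x = \<phi> y) = (x = y)" if "x \<in> carr A" "y \<in> carr A" for x y
    proof
      assume "\<phi> x = \<phi> y"
      then have "\<Psi> (x, - g x / l) = \<Psi> (y, - g y / l)" using that l by (simp add: split)
      then show "x = y" using inj that by fastforce
    qed simp
    show "\<exists>x\<in>carr A. y = \<phi> x" if "y \<in> carr A" for y
    proof -
      have "(y, 0) \<in> \<Psi> ` (carr A \<times> UNIV)"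
        using isomorphismD(1)[OF \<Psi>] that by (auto simp: bij_betw_def)
      then show ?thesis using split by force
    qed
  qed (rule \<phi>_carr)
  then have "\<phi> \<in> Aut A"
    using mult linear by (auto simp: Aut_def isomorphism_def linear_from_def)
  moreover have "linear_from A (*) (\<lambda>x. - g x / l)"
    using linear l by (auto simp: linear_from_def field_simps)
  moreover have "\<theta> x y = (1 / l) * \<theta>' (\<phi> x) (\<phi> y) + (- g (mul A x y) / l)"
    if "x \<in> carr A" "y \<in> carr A" for x y
    using mult[OF that] l by (auto simp: field_simps)
  ultimately show ?thesis
    using l unfolding cocycle_equiv_def
    by (intro bexI[of _ \<phi>] exI[of _ "1 / l"] exI[of _ "\<lambda>x. - g x / l"]) auto
qed

lemma dim_Ann_ext:
  assumes A: "algebra A" and ann: "Ann_cocycle A \<theta> \<inter> Ann A = {0}"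
  shows "vector_space.dim (scl (ext A (*) \<theta>)) (Ann (ext A (*) \<theta>)) = 1"
proof -
  interpret e: vector_space "scl (ext A (*) \<theta>)"
    using A vector_space_field by (rule vector_space_ext)
  interpret a: vector_space "scl A" using A by (rule algebra_vs)
  have "(0, v) \<in> e.span {(0, 1)}" for v
    using e.span_scale[OF e.span_base[of "(0, 1)" "{(0, 1)}"], of v] by simp
  then show ?thesis
    by (intro e.dim_unique[of "{(0, 1)}"]) (auto simp: Ann_ext ann zero_prod_def)
qed

text \<open>
  A complement \<open>E0\<close> of the coefficient line contains lifts \<open>(x, u)\<close> and \<open>(y, v)\<close> of all
  \<open>x\<close> and \<open>y\<close>. If \<open>x\<close> annihilates \<open>A\<close>, their products \<open>(0, \<theta> x y)\<close> and
  \<open>(0, \<theta> y x)\<close> lie in \<open>E0\<close> and in the line, so they vanish: a nonzero annihilator of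
  \<open>A\<close> would be contained in that of \<open>\<theta>\<close>, contrary to the hypothesis.
\<close>

lemma non_split_ext:
  assumes A: "algebra A" and bil: "bilinear_from A (*) \<theta>"
    and ann: "Ann_cocycle A \<theta> \<inter> Ann A = {0}" and nontriv: "Ann A \<noteq> {0}"
  shows "non_split (ext A (*) \<theta>)"
  unfolding non_split_def
proof (rule notI, elim exE conjE)
  fix I E0
  let ?E = "ext A (*) \<theta>"
  interpret e: vector_space "scl ?E"
    using A vector_space_field by (rule vector_space_ext)
  interpret a: vector_space "scl A" using A by (rule algebra_vs)
  assume I: "module.subspace (scl ?E) I" "I \<noteq> {0}" "I \<subseteq> Ann ?E"
    and E0: "ideal_of ?E E0" "E0 \<inter> I = {0}" "carr ?E = {x + v | x v. x \<in> E0 \<and> v \<in> I}"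
  have I_sub: "I \<subseteq> {0} \<times> UNIV" using I(3) by (simp add: Ann_ext ann)
  have "0 \<in> I" using I(1) by (rule e.subspace_0)
  then obtain w where w: "(0, w) \<in> I" "w \<noteq> 0" using I(2) I_sub by (auto simp: zero_prod_def)
  have I_all: "(0, v) \<in> I" for v
    using e.subspace_scale[OF I(1) w(1), of "v / w"] w(2) by simp
  \<comment> \<open>\<open>I\<close> is the whole coefficient line, so \<open>E0\<close> projects onto \<open>A\<close>.\<close>
  have lift: "\<exists>v. (x, v) \<in> E0" if x: "x \<in> carr A" for x
  proof -
    have "(x, 0) \<in> carr ?E" using x by simp
    then obtain p q where pq: "p \<in> E0" "q \<in> I" "(x, 0) = p + q" using E0(3) by blast
    then have "fst q = 0" using I_sub by auto
    then have "p = (x, snd p)" using pq(3) by (cases p, cases q) auto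
    then show ?thesis using pq(1) by metis
  qed
  have "0 \<in> Ann A" using ann by auto
  then obtain x where x: "x \<in> Ann A" "x \<noteq> 0" using nontriv by auto
  then have xA: "x \<in> carr A" by (simp add: Ann_def)
  then obtain y where y: "y \<in> carr A" "\<theta> x y \<noteq> 0 \<or> \<theta> y x \<noteq> 0"
    using x ann by (auto simp: Ann_cocycle_def)
  obtain u v where uv: "(x, u) \<in> E0" "(y, v) \<in> E0" using lift xA y(1) by blast
  have "mul ?E (x, u) (y, v) \<in> E0" "mul ?E (y, v) (x, u) \<in> E0"
    using E0(1) uv y(1) unfolding ideal_of_def by (metis SigmaI UNIV_I ext_simps(1))+
  then have "(0, \<theta> x y) \<in> E0" "(0, \<theta> y x) \<in> E0" using x(1) y(1) by (auto simp: Ann_def)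
  then have "(0, \<theta> x y) \<in> E0 \<inter> I" "(0, \<theta> y x) \<in> E0 \<inter> I"
    by (simp_all add: I_all)
  then show False unfolding E0(2) using y(2) by (simp add: zero_prod_def)
qed

lemma nonsplit_ext_ann1:
  assumes "algebra A" "in_variety M A" "\<theta> \<in> Z2 M A (*)"
    and "Ann_cocycle A \<theta> \<inter> Ann A = {0}" "Ann A \<noteq> {0}"
  shows "nonsplit_central_extension_ann1 M A (*) (ext A (*) \<theta>)"
proof -
  have bil: "bilinear_from A (*) \<theta>" using assms(3) Z2_in_LC Z2_LC_D(1) by blast
  show ?thesis
    using assms bil algebra_ext[OF assms(1) vector_space_field bil] in_variety_ext[OF assms(2,3)]
      non_split_ext[OF assms(1) bil assms(4,5)] dim_Ann_ext[OF assms(1,4)]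
      vector_space_field isomorphic_refl[of "ext A (*) \<theta>"]
    by (auto simp: nonsplit_central_extension_ann1_def central_extension_def intro: exI[of _ 1])
qed

text \<open>
  A generator of the coefficient line turns the cocycle into one with values in the field; the
  coordinate with respect to that generator is an isomorphism of the extensions.
\<close>

lemma ext_by_line:
  assumes A: "algebra A" and s: "vector_space s" and \<theta>: "\<theta> \<in> Z2 M A s"
    and v: "v \<noteq> 0" "range (\<lambda>c. s c v) = UNIV"
  shows "\<exists>\<eta>\<in>Z2 M A (*). isomorphic (ext A s \<theta>) (ext A (*) \<eta>) \<and> Ann_cocycle A \<eta> = Ann_cocycle A \<theta>"
proof -
  interpret s: vector_space s by fact
  define r where "r = (\<lambda>w. SOME c. s c v = w)"
  have sr: "s (r w) v = w" for w
  proof -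
    have "\<exists>c. s c v = w" using v(2) by (metis rangeE UNIV_I)
    then show ?thesis unfolding r_def by (rule someI_ex)
  qed
  have rI: "r w = c" if "w = s c v" for w c
    using that sr[of w] v(1) by simp
  have r_add: "r (x + y) = r x + r y" for x y
    by (rule rI) (simp add: s.scale_left_distrib sr)
  have r_scale: "r (s c x) = c * r x" for c x
    by (rule rI) (simp add: sr flip: s.scale_scale)
  have r_0: "r w = 0 \<longleftrightarrow> w = 0" for w using sr[of w] rI[of w 0] by auto
  define \<eta> where "\<eta> = (\<lambda>x y. r (\<theta> x y))"
  have "bilinear_from A (*) \<eta>" "on_carr A \<eta> = \<eta>"
  proof -
    have bil: "bilinear_from A s \<theta>" and on: "on_carr A \<theta> = \<theta>"
      using \<theta> Z2_in_LC Z2_LC_D(1,2) by blast+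
    show "bilinear_from A (*) \<eta>"
      using bilinear_fromD[OF bil] by (auto simp: bilinear_from_def linear_from_def \<eta>_def r_add r_scale)
    show "on_carr A \<eta> = \<eta>"
    proof (intro ext)
      fix x y
      have "\<theta> x y = on_carr A \<theta> x y" by (simp add: on)
      then show "on_carr A \<eta> x y = \<eta> x y"
        using r_0[of 0] by (simp add: on_carr_def \<eta>_def split: if_splits)
    qed
  qed
  then have "\<eta> \<in> Z2 M A (*)"
    using \<theta> by (cases M) (auto simp: Z2_BC_def Z2_LC_def Bil_def \<eta>_def)
  moreover have "Ann_cocycle A \<eta> = Ann_cocycle A \<theta>"
    by (simp add: Ann_cocycle_def \<eta>_def r_0)
  moreover have "isomorphism (ext A s \<theta>) (ext A (*) \<eta>) (\<lambda>(x, w). (x, r w))"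
    unfolding isomorphism_def
  proof (intro conjI)
    show "bij_betw (\<lambda>(x, w). (x, r w)) (carr (ext A s \<theta>)) (carr (ext A (*) \<eta>))"
      by (rule bij_betw_byWitness[where f' = "\<lambda>(x, c). (x, s c v)"]) (auto simp: sr rI)
  qed (auto simp: linear_from_def[of "ext A s \<theta>"] r_add r_scale \<eta>_def)
  ultimately show ?thesis unfolding isomorphic_def by blast
qed

text \<open>
  The coefficient space embeds into the annihilator, which is a line. Since it is nonzero, it is
  all of the annihilator; this makes it a line and leaves no common annihilator of the algebra and
  the cocycle.
\<close>

lemma nonsplit_central_extension_cocycle:
  fixes s :: "'f::field \<Rightarrow> 'w::ab_group_add \<Rightarrow> 'w"
  assumes A: "algebra A" and E: "nonsplit_central_extension_ann1 M A s E"
  shows "\<exists>\<eta>\<in>Z2 M A (*). isomorphic E (ext A (*) \<eta>) \<and> Ann_cocycle A \<eta> \<inter> Ann A = {0}"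
proof -
  have algE: "algebra E" and s: "vector_space s" and dim: "vector_space.dim (scl E) (Ann E) = 1"
    using E by (auto simp: nonsplit_central_extension_ann1_def central_extension_def)
  obtain v :: 'w where v: "v \<noteq> 0"
    using E by (auto simp: nonsplit_central_extension_ann1_def central_extension_def)
  obtain \<theta> \<Psi> where \<theta>: "\<theta> \<in> Z2 M A s" and \<Psi>: "isomorphism E (ext A s \<theta>) \<Psi>"
    using E by (auto simp: nonsplit_central_extension_ann1_def central_extension_def isomorphic_def)
  have bil: "bilinear_from A s \<theta>" using \<theta> Z2_in_LC Z2_LC_D(1) by blast
  interpret e: vector_space "scl E" using algE by (rule algebra_vs)
  interpret s: vector_space s by (rule s)
  interpret a: vector_space "scl A" using A by (rule algebra_vs)
  obtain B where B: "B \<subseteq> Ann E" "Ann E \<subseteq> e.span B" "card B = 1"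
    using e.basis_exists[of "Ann E"] dim by metis
  then obtain b where b: "b \<in> Ann E" "Ann E \<subseteq> range (\<lambda>k. scl E k b)"
    by (auto simp: card_1_singleton_iff e.span_singleton)
  obtain a0 w0 where aw: "\<Psi> b = (a0, w0)" by force
  have line: "\<exists>k. p = (scl A k a0, s k w0)" if p: "p \<in> Ann (ext A s \<theta>)" for p
  proof -
    obtain z where z: "z \<in> Ann E" "p = \<Psi> z"
      using p isomorphism_image_Ann[OF algE algebra_ext[OF A s bil] \<Psi>] by auto
    then obtain k where "z = scl E k b" using b(2) by auto
    then show ?thesis
      using z(2) linear_fromD(2)[OF isomorphismD(2)[OF \<Psi>], of b k] b(1) aw
      by (auto simp: Ann_def)
  qed
  have zero: "0 \<in> Ann_cocycle A \<theta> \<inter> Ann A"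
    using algebra_closed(1)[OF A] bilinear_from_zero[OF A bil]
      bilinear_from_zero[OF A, of "scl A" "mul A"] A
    by (auto simp: Ann_cocycle_def Ann_def algebra_def)
  then obtain k0 where k0: "(0, v) = (scl A k0 a0, s k0 w0)" using line[of "(0, v)"] by (auto simp: Ann_ext)
  \<comment> \<open>The line is spanned by \<open>(a0, w0)\<close> and contains \<open>(0, v)\<close>, which is nonzero.\<close>
  have a0: "a0 = 0" using k0 v by auto
  have "Ann_cocycle A \<theta> \<inter> Ann A = {0}"
    using line zero by (auto simp: Ann_ext a0)
  moreover have "range (\<lambda>c. s c v) = UNIV"
  proof -
    have "\<exists>c. w = s c v" for w
    proof -
      obtain k where "w = s k w0" using line[of "(0, w)"] zero by (auto simp: Ann_ext)
      moreover have "k0 \<noteq> 0" using k0 v by auto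
      ultimately have "w = s (k / k0) v" using k0 by simp
      then show ?thesis by blast
    qed
    then show ?thesis by blast
  qed
  ultimately obtain \<eta> where "\<eta> \<in> Z2 M A (*)" "isomorphic (ext A s \<theta>) (ext A (*) \<eta>)"
      "Ann_cocycle A \<eta> \<inter> Ann A = {0}"
    using ext_by_line[OF A s \<theta> v] by auto
  moreover have "isomorphic E (ext A s \<theta>)" using \<Psi> by (auto simp: isomorphic_def)
  ultimately show ?thesis using isomorphic_trans by blast
qed

unbundle fps_syntax

section \<open>The null-filiform algebra and its automorphisms\<close>

lemma in_carr_mu0: "x \<in> carr (mu0 n) \<longleftrightarrow> (\<forall>k. k \<notin> {1..n} \<longrightarrow> x k = 0)"
  by (simp add: mu0_def)

lemma scl_mu0 [simp]: "scl (mu0 n) c x = (\<lambda>k. c * x k)"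
  by (simp add: mu0_def)

text \<open>
  Together with \<open>Abs_fps\<close>, this identifies \<open>mu0 n\<close> with the power series without constant
  term, modulo \<open>fps_X ^ (n + 1)\<close>.
\<close>

definition trunc_fps :: "nat \<Rightarrow> 'f::field fps \<Rightarrow> nat \<Rightarrow> 'f" where
  "trunc_fps n F = (\<lambda>k. if k \<in> {1..n} then F $ k else 0)"

lemma trunc_fps_in_carr: "trunc_fps n F \<in> carr (mu0 n)"
  by (simp add: in_carr_mu0 trunc_fps_def)

lemma mul_mu0:
  assumes x: "x \<in> carr (mu0 n)" and y: "y \<in> carr (mu0 n)"
  shows "mul (mu0 n) x y = trunc_fps n (Abs_fps x * Abs_fps y)"
proof
  fix k
  have x0: "x 0 = 0" and y0: "y 0 = 0" using x y by (auto simp: in_carr_mu0)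
  have inner: "(\<Sum>j=1..n. x i * y j * bvec n (i + j) k) = (if k \<le> n \<and> i \<le> k then x i * y (k - i) else 0)"
    if "i \<in> {1..n}" for i
  proof -
    have "(\<Sum>j=1..n. x i * y j * bvec n (i + j) k) =
        (\<Sum>j=1..n. if j = k - i then (if k \<le> n \<and> i \<le> k then x i * y (k - i) else 0) else 0)"
      by (rule sum.cong) (use that in \<open>auto simp: bvec_def\<close>)
    also have "\<dots> = (if k \<le> n \<and> i \<le> k then x i * y (k - i) else 0)"
      using y0 by (auto simp: Suc_le_eq)
    finally show ?thesis .
  qed
  have "mul (mu0 n) x y k = (\<Sum>i=1..n. if k \<le> n \<and> i \<le> k then x i * y (k - i) else 0)"
    using inner by (simp add: mu0_def)
  also have "\<dots> = trunc_fps n (Abs_fps x * Abs_fps y) k"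
  proof (cases "k \<le> n")
    case True
    then have "(\<Sum>i=1..n. if k \<le> n \<and> i \<le> k then x i * y (k - i) else 0) =
        (\<Sum>i=0..k. x i * y (k - i))"
      using x0 by (intro sum.mono_neutral_cong) (auto simp: Suc_le_eq)
    then show ?thesis using True x0 y0 by (auto simp: trunc_fps_def fps_mult_nth Suc_le_eq)
  qed (simp add: trunc_fps_def)
  finally show "mul (mu0 n) x y k = trunc_fps n (Abs_fps x * Abs_fps y) k" .
qed

lemma trunc_fps_nth: "F $ 0 = 0 \<Longrightarrow> k \<le> n \<Longrightarrow> trunc_fps n F k = F $ k"
  by (cases k) (auto simp: trunc_fps_def)

lemma trunc_fps_mult_cong:
  assumes "\<And>k. k \<le> n \<Longrightarrow> F $ k = F' $ k" "\<And>k. k \<le> n \<Longrightarrow> G $ k = G' $ k"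
  shows "trunc_fps n (F * G) = trunc_fps n (F' * G')"
  using assms by (auto simp: trunc_fps_def fps_mult_nth fun_eq_iff intro!: sum.cong)

text \<open>
  Truncation is multiplicative on series without constant term; associativity and all
  commutativity laws of \<open>mu0 n\<close> come from power series in this way.
\<close>

lemma mul_mu0_trunc_fps:
  assumes "F $ 0 = 0" "G $ 0 = 0"
  shows "mul (mu0 n) (trunc_fps n F) (trunc_fps n G) = trunc_fps n (F * G)"
  unfolding mul_mu0[OF trunc_fps_in_carr trunc_fps_in_carr]
  by (rule trunc_fps_mult_cong) (simp_all add: assms trunc_fps_nth)

lemma trunc_fps_Abs_fps: "x \<in> carr (mu0 n) \<Longrightarrow> trunc_fps n (Abs_fps x) = x"
  by (auto simp: in_carr_mu0 trunc_fps_def fun_eq_iff)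

lemma carr_mu0_nth_0: "x \<in> carr (mu0 n) \<Longrightarrow> x 0 = 0"
  by (simp add: in_carr_mu0)

lemma mul_mul_mu0:
  assumes "x \<in> carr (mu0 n)" "y \<in> carr (mu0 n)" "z \<in> carr (mu0 n)"
  shows "mul (mu0 n) x (mul (mu0 n) y z) = trunc_fps n (Abs_fps x * (Abs_fps y * Abs_fps z))"
    and "mul (mu0 n) (mul (mu0 n) x y) z = trunc_fps n (Abs_fps x * Abs_fps y * Abs_fps z)"
proof -
  note carr0 = assms[THEN carr_mu0_nth_0] and trunc = assms[THEN trunc_fps_Abs_fps]
  show "mul (mu0 n) x (mul (mu0 n) y z) = trunc_fps n (Abs_fps x * (Abs_fps y * Abs_fps z))"
    using mul_mu0_trunc_fps[of "Abs_fps x" "Abs_fps y * Abs_fps z" n] carr0 trunc(1)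
    by (simp add: mul_mu0[OF assms(2,3)])
  show "mul (mu0 n) (mul (mu0 n) x y) z = trunc_fps n (Abs_fps x * Abs_fps y * Abs_fps z)"
    using mul_mu0_trunc_fps[of "Abs_fps x * Abs_fps y" "Abs_fps z" n] carr0 trunc(3)
    by (simp add: mul_mu0[OF assms(1,2)])
qed

lemma mul_mu0_commute:
  "x \<in> carr (mu0 n) \<Longrightarrow> y \<in> carr (mu0 n) \<Longrightarrow> mul (mu0 n) x y = mul (mu0 n) y x"
  by (simp add: mul_mu0 mult.commute)

lemma in_variety_mu0: "in_variety M (mu0 n)"
  by (cases M) (simp_all add: left_commutative_def right_commutative_def mul_mul_mu0 ac_simps)

lemma mul_bvec_all:
  assumes "1 \<le> i" "1 \<le> j"
  shows "mul (mu0 n) (bvec n i) (bvec n j) = bvec n (i + j)"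
proof (cases "i \<le> n \<and> j \<le> n")
  case True
  then show ?thesis using assms by (intro mul_bvec) auto
next
  case False
  then have "bvec n i = (0 :: nat \<Rightarrow> 'a) \<or> bvec n j = (0 :: nat \<Rightarrow> 'a)" "bvec n (i + j) = (0 :: nat \<Rightarrow> 'a)"
    by (auto simp: bvec_def fun_eq_iff)
  then show ?thesis by (auto simp: mu0_def fun_eq_iff)
qed

definition subst_map :: "nat \<Rightarrow> 'f::field fps \<Rightarrow> (nat \<Rightarrow> 'f) \<Rightarrow> nat \<Rightarrow> 'f" where
  "subst_map n P x = trunc_fps n (Abs_fps x oo P)"

lemma subst_map_comp:
  assumes "P $ 0 = 0" "Q $ 0 = 0" "x \<in> carr (mu0 n)"
  shows "subst_map n P (subst_map n Q x) = subst_map n (Q oo P) x"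
proof -
  have "(Abs_fps (trunc_fps n (Abs_fps x oo Q)) oo P) $ k = (Abs_fps x oo Q oo P) $ k" if "k \<le> n" for k
    unfolding fps_compose_nth[of _ P]
    using that assms by (intro sum.cong refl) (simp add: trunc_fps_nth carr_mu0_nth_0)
  then show ?thesis
    using assms by (auto simp: subst_map_def trunc_fps_def[of n "_ oo P"] trunc_fps_def[of n "_ oo (_ oo _)"]
        fps_compose_assoc)
qed

text \<open>
  The inverse of the substitution is the substitution of the compositional inverse of \<open>P\<close>.
\<close>

lemma subst_map_Aut:
  fixes P :: "'f::field fps"
  assumes "P $ 0 = 0" "P $ 1 \<noteq> 0"
  shows "subst_map n P \<in> Aut (mu0 n)"
proof -
  have inv0: "fps_inv P $ 0 = 0" by (simp add: fps_inv_def)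
  have id: "subst_map n fps_X x = x" if "x \<in> carr (mu0 n)" for x :: "nat \<Rightarrow> 'f"
    using that by (simp add: subst_map_def trunc_fps_Abs_fps)
  have "bij_betw (subst_map n P) (carr (mu0 n)) (carr (mu0 n))"
  proof (rule bij_betw_byWitness[where f' = "subst_map n (fps_inv P)"])
    show "\<forall>x\<in>carr (mu0 n). subst_map n (fps_inv P) (subst_map n P x) = x"
      using assms inv0 by (simp add: subst_map_comp fps_inv_right id)
    show "\<forall>x\<in>carr (mu0 n). subst_map n P (subst_map n (fps_inv P) x) = x"
      using assms inv0 by (simp add: subst_map_comp fps_inv id)
  qed (auto simp: subst_map_def trunc_fps_in_carr)
  moreover have "linear_from (mu0 n) (scl (mu0 n)) (subst_map n P)"
    by (auto simp: linear_from_def subst_map_def trunc_fps_def fun_eq_iff fps_compose_nth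
        sum.distrib sum_distrib_left algebra_simps)
  moreover have "subst_map n P (mul (mu0 n) x y) = mul (mu0 n) (subst_map n P x) (subst_map n P y)"
    if x: "x \<in> carr (mu0 n)" and y: "y \<in> carr (mu0 n)" for x y
  proof -
    have "subst_map n P (mul (mu0 n) x y) = trunc_fps n (Abs_fps x * Abs_fps y oo P)"
      using x y assms
      by (auto simp: subst_map_def mul_mu0 trunc_fps_def[of n "_ oo P"] fun_eq_iff fps_compose_nth
          trunc_fps_nth carr_mu0_nth_0 intro!: sum.cong)
    also have "\<dots> = mul (mu0 n) (subst_map n P x) (subst_map n P y)"
      using assms x y
      by (simp add: fps_compose_mult_distrib subst_map_def mul_mu0_trunc_fps carr_mu0_nth_0)
    finally show ?thesis .
  qed
  ultimately show ?thesis by (auto simp: Aut_def isomorphism_def)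
qed

lemma subst_map_bvec:
  assumes "P $ 0 = 0" "i \<in> {1..n}"
  shows "subst_map n P (bvec n i) = trunc_fps n (P ^ i)"
proof
  fix k
  have "P ^ i $ k = 0" if "\<not> i \<le> k"
    using that assms(1) startsby_zero_power_prefix by (metis not_le)
  then show "subst_map n P (bvec n i) k = trunc_fps n (P ^ i) k"
    using assms(2) by (auto simp: subst_map_def trunc_fps_def fps_compose_nth bvec_def mult_delta_left)
qed

lemma linear_from_mu0_expand:
  assumes f: "linear_from (mu0 n) (*) f" and x: "x \<in> carr (mu0 n)"
  shows "f x = (\<Sum>i=1..n. x i * f (bvec n i))"
proof -
  have partial: "f (\<lambda>k. \<Sum>i\<in>S. x i * bvec n i k) = (\<Sum>i\<in>S. x i * f (bvec n i))" if "finite S" for S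
    using that
  proof induction
    case empty
    then show ?case
      using linear_from_zero[OF algebra_mu0 f] by (simp add: zero_fun_def)
  next
    case (insert j S)
    let ?r = "\<lambda>k. \<Sum>i\<in>S. x i * bvec n i k"
    have "?r \<in> carr (mu0 n)" by (auto simp: in_carr_mu0 bvec_def intro!: sum.neutral)
    moreover have "(\<lambda>k. \<Sum>i\<in>insert j S. x i * bvec n i k) = scl (mu0 n) (x j) (bvec n j) + ?r"
      using insert.hyps by (simp add: fun_eq_iff)
    ultimately show ?case
      using insert linear_fromD[OF f] algebra_closed(3)[OF algebra_mu0, of "bvec n j" n "x j"]
      by (simp add: bvec_in_carr)
  qed
  have "x = (\<lambda>k. \<Sum>i=1..n. x i * bvec n i k)"
    by (rule ext) (rule carr_mu0_expand[OF x])
  then have "f x = f (\<lambda>k. \<Sum>i=1..n. x i * bvec n i k)" by (rule arg_cong)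
  then show ?thesis by (simp only: partial[OF finite_atLeastAtMost])
qed

lemma bilinear_from_mu0_expand:
  assumes \<theta>: "bilinear_from (mu0 n) (*) \<theta>" and x: "x \<in> carr (mu0 n)" and y: "y \<in> carr (mu0 n)"
  shows "\<theta> x y = (\<Sum>i=1..n. \<Sum>j=1..n. x i * y j * \<theta> (bvec n i) (bvec n j))"
proof -
  have "\<theta> x y = (\<Sum>i=1..n. x i * \<theta> (bvec n i) y)"
    using \<theta> y by (intro linear_from_mu0_expand[OF _ x]) (simp add: bilinear_from_def)
  moreover have "\<theta> (bvec n i) y = (\<Sum>j=1..n. y j * \<theta> (bvec n i) (bvec n j))" for i
    using \<theta> by (intro linear_from_mu0_expand[OF _ y]) (simp add: bilinear_from_def bvec_in_carr)
  ultimately show ?thesis by (simp add: sum_distrib_left mult.assoc)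
qed

lemma bilinear_from_mu0_eqI:
  assumes "bilinear_from (mu0 n) (*) \<theta>" "bilinear_from (mu0 n) (*) \<eta>"
    and "\<And>i j. i \<in> {1..n} \<Longrightarrow> j \<in> {1..n} \<Longrightarrow> \<theta> (bvec n i) (bvec n j) = \<eta> (bvec n i) (bvec n j)"
    and "x \<in> carr (mu0 n)" "y \<in> carr (mu0 n)"
  shows "\<theta> x y = \<eta> x y"
  using assms by (simp add: bilinear_from_mu0_expand)

text \<open>
  The image of $e_i$ is the \<open>i\<close>-th power of the image $c X + \dots$ of $e_1 = X$, hence
  $c^i X^i + \dots$ .
\<close>

lemma Aut_mu0_bvec:
  fixes \<phi> :: "(nat \<Rightarrow> 'f::field) \<Rightarrow> nat \<Rightarrow> 'f"
  assumes \<phi>: "\<phi> \<in> Aut (mu0 n)" and i: "1 \<le> i" "i \<le> n"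
  shows "l < i \<Longrightarrow> \<phi> (bvec n i) l = 0"
    and "\<phi> (bvec n i) i = \<phi> (bvec n 1) 1 ^ i"
proof -
  let ?p = "\<phi> (bvec n 1)"
  have carr: "\<phi> (bvec n j) \<in> carr (mu0 n)" for j
    using AutD(1)[OF \<phi>] bvec_in_carr by blast
  have "i \<le> n \<Longrightarrow> (\<forall>l<i. \<phi> (bvec n i) l = 0) \<and> \<phi> (bvec n i) i = ?p 1 ^ i"
    using i(1)
  proof (induction i rule: dec_induct)
    case base
    then show ?case using carr[of 1] by (auto simp: in_carr_mu0)
  next
    case (step i)
    let ?q = "\<phi> (bvec n i)"
    have q: "?q l = 0" if "l < i" for l using step that by simp
    have p0: "?p 0 = 0" using carr[of 1] by (auto simp: in_carr_mu0)
    have "\<phi> (bvec n (Suc i)) = mul (mu0 n) ?p ?q"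
      using AutD(2)[OF \<phi>, of "bvec n 1" "bvec n i"] mul_bvec_all[of 1 i n, where ?'a = 'f] step.hyps
      by (simp add: bvec_in_carr)
    also have "\<dots> = trunc_fps n (Abs_fps ?p * Abs_fps ?q)" by (rule mul_mu0[OF carr carr])
    finally have eq: "\<phi> (bvec n (Suc i)) = trunc_fps n (Abs_fps ?p * Abs_fps ?q)" .
    have "(Abs_fps ?p * Abs_fps ?q) $ l = 0" if "l < Suc i" for l
      unfolding fps_mult_nth
    proof (rule sum.neutral, rule ballI)
      fix j assume "j \<in> {0..l}"
      then show "Abs_fps ?p $ j * Abs_fps ?q $ (l - j) = 0"
        using p0 q[of "l - j"] that by (cases "j = 0") auto
    qed
    moreover have "(Abs_fps ?p * Abs_fps ?q) $ Suc i = ?p 1 * ?q i"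
    proof -
      have "(Abs_fps ?p * Abs_fps ?q) $ Suc i = (\<Sum>j=0..Suc i. if j = 1 then ?p 1 * ?q i else 0)"
        unfolding fps_mult_nth
      proof (rule sum.cong[OF refl])
        fix j assume "j \<in> {0..Suc i}"
        then show "Abs_fps ?p $ j * Abs_fps ?q $ (Suc i - j) = (if j = 1 then ?p 1 * ?q i else 0)"
          using p0 q[of "Suc i - j"] by (cases "j = 0"; cases "j = 1") auto
      qed
      then show ?thesis by simp
    qed
    ultimately show ?case using step unfolding eq by (auto simp: trunc_fps_def)
  qed
  then show "l < i \<Longrightarrow> \<phi> (bvec n i) l = 0" "\<phi> (bvec n i) i = ?p 1 ^ i" using i by auto
qed

text \<open>
  Otherwise no image of a basis vector would have an $e_1$-component, and $e_1$ would not be in the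
  range.
\<close>

lemma Aut_mu0_lead_nonzero:
  fixes \<phi> :: "(nat \<Rightarrow> 'f::field) \<Rightarrow> nat \<Rightarrow> 'f"
  assumes \<phi>: "\<phi> \<in> Aut (mu0 n)" and n: "n \<ge> 1"
  shows "\<phi> (bvec n 1) 1 \<noteq> 0"
proof
  assume zero: "\<phi> (bvec n 1) 1 = 0"
  have "bvec n 1 \<in> \<phi> ` carr (mu0 n)"
    using \<phi> bvec_in_carr[of n 1] by (auto simp: Aut_def isomorphism_def bij_betw_def)
  then obtain x where x: "x \<in> carr (mu0 n)" "bvec n 1 = \<phi> x" by auto
  have "linear_from (mu0 n) (*) (\<lambda>x. \<phi> x 1)"
    using AutD(3,4)[OF \<phi>] by (auto simp: linear_from_def)
  then have "\<phi> x 1 = (\<Sum>i=1..n. x i * \<phi> (bvec n i) 1)"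
    using x(1) by (rule linear_from_mu0_expand)
  also have "\<dots> = 0"
  proof (rule sum.neutral, rule ballI)
    fix i assume "i \<in> {1..n}"
    then show "x i * \<phi> (bvec n i) 1 = 0"
      using zero Aut_mu0_bvec(1)[OF \<phi>, of i 1] by (cases "i = 1") auto
  qed
  finally show False using x(2) n by (metis bvec_def le_refl zero_neq_one)
qed

text \<open>
  Multiplication by $e_1$ shifts coordinates by one and loses the last coordinate only.
\<close>

lemma Ann_mu0:
  assumes n: "n \<ge> 2"
  shows "Ann (mu0 n) = {x. \<forall>k. k \<noteq> n \<longrightarrow> x k = 0}"
proof (intro set_eqI iffI)
  fix x :: "nat \<Rightarrow> 'f::field"
  assume x: "x \<in> Ann (mu0 n)"
  then have xc: "x \<in> carr (mu0 n)" and zero: "mul (mu0 n) (bvec n 1) x = 0"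
    by (auto simp: Ann_def bvec_in_carr)
  have "x k = 0" if "k \<in> {1..<n}" for k
  proof -
    have "x k = (fps_X * Abs_fps x) $ Suc k" by simp
    also have "fps_X = Abs_fps (bvec n 1)"
      using n by (auto simp: fps_eq_iff bvec_def)
    also have "(Abs_fps (bvec n 1) * Abs_fps x) $ Suc k = mul (mu0 n) (bvec n 1) x (Suc k)"
      using that by (simp add: mul_mu0 bvec_in_carr xc trunc_fps_def)
    finally show ?thesis using zero by simp
  qed
  moreover have "x k = 0" if "k \<notin> {1..n}" for k using xc that by (simp add: in_carr_mu0)
  ultimately have "x k = 0" if "k \<noteq> n" for k using that by (cases "k \<in> {1..n}") auto
  then show "x \<in> {x. \<forall>k. k \<noteq> n \<longrightarrow> x k = 0}" by simp
next
  fix x :: "nat \<Rightarrow> 'f::field"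
  assume x: "x \<in> {x. \<forall>k. k \<noteq> n \<longrightarrow> x k = 0}"
  then have xc: "x \<in> carr (mu0 n)" using n by (auto simp: in_carr_mu0)
  have "mul (mu0 n) x y = 0" if y: "y \<in> carr (mu0 n)" for y
  proof -
    have y0: "y 0 = 0" using y by (simp add: in_carr_mu0)
    have "x i * y (k - i) = 0" if "k \<le> n" "i \<le> k" for i k
      using x that y0 by (cases "i = n") auto
    then show ?thesis
      by (auto simp: mul_mu0[OF xc y] trunc_fps_def fps_mult_nth fun_eq_iff intro!: sum.neutral)
  qed
  then show "x \<in> Ann (mu0 n)" using xc by (simp add: Ann_def mul_mu0_commute[of _ n x])
qed

section \<open>Coordinates of cohomology classes\<close>

text \<open>
  The cocycle condition without the requirement to vanish outside the carrier, so that it applies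
  to expressions such as the difference of a cocycle and a pull-back.
\<close>

definition lc_cocycle :: "('f::field, 'v::ab_group_add) nalg \<Rightarrow> ('v \<Rightarrow> 'v \<Rightarrow> 'f) \<Rightarrow> bool" where
  "lc_cocycle A \<theta> \<longleftrightarrow> bilinear_from A (*) \<theta> \<and>
     (\<forall>x\<in>carr A. \<forall>y\<in>carr A. \<forall>z\<in>carr A. \<theta> x (mul A y z) = \<theta> y (mul A x z))"

lemma lc_cocycleD:
  assumes "lc_cocycle A \<theta>" "x \<in> carr A" "y \<in> carr A" "z \<in> carr A"
  shows "\<theta> x (mul A y z) = \<theta> y (mul A x z)"
  using assms unfolding lc_cocycle_def by blast

lemma lc_cocycle_Z2: "\<theta> \<in> Z2 M A (*) \<Longrightarrow> lc_cocycle A \<theta>"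
  using Z2_in_LC[of \<theta> M A] by (auto simp: lc_cocycle_def Z2_LC_def Bil_def)

text \<open>
  The coordinates of a class in second cohomology, namely the coefficients of \<open>nabla n n\<close> and of
  \<open>Delta n i 1\<close>. They vanish on coboundaries, because $e_1 e_n = 0$ and because the algebra is
  commutative.
\<close>

definition top_coeff :: "nat \<Rightarrow> ((nat \<Rightarrow> 'f::field) \<Rightarrow> (nat \<Rightarrow> 'f) \<Rightarrow> 'f) \<Rightarrow> 'f" where
  "top_coeff n \<theta> = \<theta> (bvec n 1) (bvec n n)"

definition skew_coeff :: "nat \<Rightarrow> ((nat \<Rightarrow> 'f::field) \<Rightarrow> (nat \<Rightarrow> 'f) \<Rightarrow> 'f) \<Rightarrow> nat \<Rightarrow> 'f" where
  "skew_coeff n \<theta> i = \<theta> (bvec n i) (bvec n 1) - \<theta> (bvec n 1) (bvec n i)"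

lemma lc_cocycle_zero:
  assumes "lc_cocycle (mu0 n) \<theta>"
  shows "\<theta> (bvec n i) 0 = 0"
  by (rule bilinear_from_zero(1)[OF algebra_mu0, of n "(*)"])
    (use assms bvec_in_carr in \<open>auto simp: lc_cocycle_def\<close>)

lemma bvec_eq_0: "n < m \<Longrightarrow> bvec n m = 0"
  by (auto simp: bvec_def fun_eq_iff)

text \<open>
  For $j \ge 2$, write $e_j = e_1 e_{j-1}$ and exchange the factor $e_1$ with $e_i$; for $j = 1$ the
  formula defines the skew coefficient.
\<close>

lemma lc_cocycle_bvec:
  assumes \<theta>: "lc_cocycle (mu0 n) \<theta>" and ij: "i \<in> {1..n}" "j \<in> {1..n}"
  shows "\<theta> (bvec n i) (bvec n j) =
    \<theta> (bvec n 1) (bvec n (i + j - 1)) + (if j = 1 then skew_coeff n \<theta> i else 0)"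
proof (cases "j = 1")
  case True
  then show ?thesis by (simp add: skew_coeff_def)
next
  case False
  then have pred: "1 \<le> j - 1" using ij by auto
  have "1 \<le> i" using ij by simp
  have "\<theta> (bvec n i) (mul (mu0 n) (bvec n 1) (bvec n (j - 1))) =
      \<theta> (bvec n 1) (mul (mu0 n) (bvec n i) (bvec n (j - 1)))"
    by (rule lc_cocycleD[OF \<theta>]) (rule bvec_in_carr)+
  then have "\<theta> (bvec n i) (bvec n (1 + (j - 1))) = \<theta> (bvec n 1) (bvec n (i + (j - 1)))"
    by (simp only: mul_bvec_all[OF order_refl pred] mul_bvec_all[OF \<open>1 \<le> i\<close> pred])
  moreover have "1 + (j - 1) = j" "i + (j - 1) = i + j - 1" using pred by auto
  ultimately show ?thesis using False by simp
qed

lemma lc_cocycle_expand: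
  assumes \<theta>: "lc_cocycle (mu0 n) \<theta>" and n: "n \<ge> 1"
    and x: "x \<in> carr (mu0 n)" and y: "y \<in> carr (mu0 n)"
  shows "\<theta> x y = (\<Sum>i=1..n. \<Sum>j=1..n. x i * y j * \<theta> (bvec n 1) (bvec n (i + j - 1)))
     + y 1 * (\<Sum>i=1..n. x i * skew_coeff n \<theta> i)"
proof -
  have "\<theta> x y = (\<Sum>i=1..n. \<Sum>j=1..n. x i * y j *
      (\<theta> (bvec n 1) (bvec n (i + j - 1)) + (if j = 1 then skew_coeff n \<theta> i else 0)))"
    using \<theta> x y bilinear_from_mu0_expand[of n \<theta> x y] lc_cocycle_bvec[OF \<theta>]
    by (simp add: lc_cocycle_def)
  also have "\<dots> = (\<Sum>i=1..n. (\<Sum>j=1..n. x i * y j * \<theta> (bvec n 1) (bvec n (i + j - 1)))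
      + y 1 * (x i * skew_coeff n \<theta> i))"
  proof (rule sum.cong[OF refl])
    fix i
    have "(\<Sum>j=1..n. x i * y j * (if j = 1 then skew_coeff n \<theta> i else 0)) =
        (\<Sum>j=1..n. if j = 1 then y 1 * (x i * skew_coeff n \<theta> i) else 0)"
      by (rule sum.cong) auto
    also have "\<dots> = y 1 * (x i * skew_coeff n \<theta> i)" using n by simp
    finally show "(\<Sum>j=1..n. x i * y j *
        (\<theta> (bvec n 1) (bvec n (i + j - 1)) + (if j = 1 then skew_coeff n \<theta> i else 0))) =
        (\<Sum>j=1..n. x i * y j * \<theta> (bvec n 1) (bvec n (i + j - 1))) + y 1 * (x i * skew_coeff n \<theta> i)"
      by (simp only: distrib_left sum.distrib)
  qed
  finally show ?thesis by (simp only: sum.distrib sum_distrib_left)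
qed

text \<open>
  The double sum in \<open>lc_cocycle_expand\<close> is symmetric in \<open>x\<close> and \<open>y\<close>, since its
  coefficients depend on $i + j$ only.
\<close>

lemma lc_cocycle_skew:
  assumes \<theta>: "lc_cocycle (mu0 n) \<theta>" and n: "n \<ge> 1"
    and x: "x \<in> carr (mu0 n)" and y: "y \<in> carr (mu0 n)"
  shows "\<theta> x y - \<theta> y x =
    y 1 * (\<Sum>i=1..n. x i * skew_coeff n \<theta> i) - x 1 * (\<Sum>i=1..n. y i * skew_coeff n \<theta> i)"
proof -
  have "(\<Sum>i=1..n. \<Sum>j=1..n. x i * y j * \<theta> (bvec n 1) (bvec n (i + j - 1))) =
      (\<Sum>i=1..n. \<Sum>j=1..n. y i * x j * \<theta> (bvec n 1) (bvec n (i + j - 1)))"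
    by (subst sum.swap) (simp add: ac_simps)
  then show ?thesis
    using lc_cocycle_expand[OF \<theta> n x y] lc_cocycle_expand[OF \<theta> n y x] by simp
qed

text \<open>
  If the coordinates vanish, $\theta(e_i, e_j)$ depends on $i + j$ only and is 0 for $i + j > n$.
  So the linear form $e_m \mapsto \theta(e_1, e_{m-1})$ has coboundary \<open>\<theta>\<close>.
\<close>

lemma lc_cocycle_coboundary:
  assumes \<theta>: "lc_cocycle (mu0 n) \<theta>" and top: "top_coeff n \<theta> = 0"
    and skew: "\<And>i. i \<in> {2..n} \<Longrightarrow> skew_coeff n \<theta> i = 0"
  obtains f where "linear_from (mu0 n) (*) f"
    "\<And>x y. x \<in> carr (mu0 n) \<Longrightarrow> y \<in> carr (mu0 n) \<Longrightarrow> \<theta> x y = f (mul (mu0 n) x y)"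
proof
  define f where "f = (\<lambda>x. \<Sum>k=2..n. x k * \<theta> (bvec n 1) (bvec n (k - 1)))"
  show f: "linear_from (mu0 n) (*) f"
    by (simp add: linear_from_def f_def sum.distrib sum_distrib_left algebra_simps)
  have f_bvec: "f (bvec n m) = (if m \<in> {2..n} then \<theta> (bvec n 1) (bvec n (m - 1)) else 0)" for m
  proof -
    have "f (bvec n m) = (\<Sum>k=2..n. if k = m then \<theta> (bvec n 1) (bvec n (m - 1)) else 0)"
      unfolding f_def by (rule sum.cong) (auto simp: bvec_def[of n m])
    then show ?thesis by simp
  qed
  have zero: "\<theta> (bvec n 1) 0 = 0" using \<theta> by (rule lc_cocycle_zero)
  have "bilinear_from (mu0 n) (*) (\<lambda>x y. f (mul (mu0 n) x y))"
  proof -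
    note alg = algebra_mu0[of n, where ?'a = 'a]
    have "bilinear_from (mu0 n) (scl (mu0 n)) (mul (mu0 n :: ('a, _) nalg))"
      using alg by (simp add: algebra_def)
    note bil = bilinear_fromD[OF this]
    show ?thesis
      using bil linear_fromD[OF f] algebra_closed(4)[OF alg]
      unfolding bilinear_from_def linear_from_def by presburger
  qed
  moreover have "\<theta> (bvec n i) (bvec n j) = f (mul (mu0 n) (bvec n i) (bvec n j))"
    if ij: "i \<in> {1..n}" "j \<in> {1..n}" for i j
  proof -
    have "skew_coeff n \<theta> i = 0"
      using skew[of i] ij by (cases "i = 1") (auto simp: skew_coeff_def)
    then have "\<theta> (bvec n i) (bvec n j) = \<theta> (bvec n 1) (bvec n (i + j - 1))"
      using lc_cocycle_bvec[OF \<theta> ij] by simp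
    also have "\<dots> = f (bvec n (i + j))"
    proof (cases "i + j \<le> n")
      case True
      then show ?thesis using ij by (simp add: f_bvec)
    next
      case False
      then have "\<theta> (bvec n 1) (bvec n (i + j - 1)) = 0"
        using top zero by (cases "i + j = n + 1") (auto simp: top_coeff_def bvec_eq_0)
      then show ?thesis using False by (simp add: f_bvec)
    qed
    finally show ?thesis using ij by (simp add: mul_bvec_all)
  qed
  ultimately show "\<theta> x y = f (mul (mu0 n) x y)" if "x \<in> carr (mu0 n)" "y \<in> carr (mu0 n)" for x y
    using that \<theta> bilinear_from_mu0_eqI[of n \<theta> "\<lambda>x y. f (mul (mu0 n) x y)" x y]
    by (simp add: lc_cocycle_def)
qed

lemma coboundary_coeffs:
  assumes "linear_from (mu0 n) (*) f" "n \<ge> 1"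
  shows "f (mul (mu0 n) (bvec n 1) (bvec n n)) = 0"
    and "f (mul (mu0 n) (bvec n i) (bvec n 1)) = f (mul (mu0 n) (bvec n 1) (bvec n i))"
  using linear_from_zero[OF algebra_mu0 assms(1)] assms(2)
  by (simp_all add: mul_bvec_all bvec_eq_0 mul_mu0_commute[OF bvec_in_carr bvec_in_carr])

text \<open>
  The image of $e_n$ is $c^n e_n$, and $\theta(e_i, e_n) = \theta(e_1, e_{i+n-1}) = 0$ for
  $i \ge 2$, so only the $e_1$-component \<open>c\<close> of the image of $e_1$ contributes.
\<close>

lemma act_top_coeff:
  fixes \<theta> :: "(nat \<Rightarrow> 'f::field) \<Rightarrow> (nat \<Rightarrow> 'f) \<Rightarrow> 'f"
  assumes \<theta>: "lc_cocycle (mu0 n) \<theta>" and \<phi>: "\<phi> \<in> Aut (mu0 n)" and n: "n \<ge> 2"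
  shows "\<theta> (\<phi> (bvec n 1)) (\<phi> (bvec n n)) = \<phi> (bvec n 1) 1 ^ (n + 1) * top_coeff n \<theta>"
proof -
  let ?p = "\<phi> (bvec n 1)" and ?q = "\<phi> (bvec n n)"
  have carr: "\<phi> (bvec n j) \<in> carr (mu0 n)" for j
    using AutD(1)[OF \<phi>] bvec_in_carr by blast
  have zero: "\<theta> (bvec n 1) 0 = 0" using \<theta> by (rule lc_cocycle_zero)
  have q: "?q j = 0" if "j < n" for j using Aut_mu0_bvec(1)[OF \<phi>, of n j] that n by simp
  have "(\<Sum>j=1..n. ?p i * ?q j * \<theta> (bvec n 1) (bvec n (i + j - 1))) =
      (if i = 1 then ?p 1 * ?q n * top_coeff n \<theta> else 0)" if i: "i \<in> {1..n}" for i
  proof -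
    have "(\<Sum>j=1..n. ?p i * ?q j * \<theta> (bvec n 1) (bvec n (i + j - 1))) =
        (\<Sum>j=1..n. if j = n then (if i = 1 then ?p 1 * ?q n * top_coeff n \<theta> else 0) else 0)"
    proof (rule sum.cong[OF refl])
      fix j assume j: "j \<in> {1..n}"
      show "?p i * ?q j * \<theta> (bvec n 1) (bvec n (i + j - 1)) =
          (if j = n then (if i = 1 then ?p 1 * ?q n * top_coeff n \<theta> else 0) else 0)"
        using i j q[of j] zero
        by (cases "j = n"; cases "i = 1") (auto simp: top_coeff_def bvec_eq_0)
    qed
    then show ?thesis using n by simp
  qed
  then have "\<theta> ?p ?q = (\<Sum>i=1..n. if i = 1 then ?p 1 * ?q n * top_coeff n \<theta> else 0)"
    using lc_cocycle_expand[OF \<theta> _ carr[of 1] carr[of n]] n q[of 1] by simp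
  also have "\<dots> = ?p 1 * ?q n * top_coeff n \<theta>" using n by simp
  finally show ?thesis using Aut_mu0_bvec(2)[OF \<phi>, of n] n by simp
qed

text \<open>
  The image of $e_i$ has no $e_1$-component when $i \ge 2$, so one of the two terms of
  \<open>lc_cocycle_skew\<close> disappears.
\<close>

lemma act_skew_coeff:
  fixes \<theta> :: "(nat \<Rightarrow> 'f::field) \<Rightarrow> (nat \<Rightarrow> 'f) \<Rightarrow> 'f"
  assumes \<theta>: "lc_cocycle (mu0 n) \<theta>" and \<phi>: "\<phi> \<in> Aut (mu0 n)" and i: "i \<in> {2..n}"
  shows "\<theta> (\<phi> (bvec n i)) (\<phi> (bvec n 1)) - \<theta> (\<phi> (bvec n 1)) (\<phi> (bvec n i)) =
    \<phi> (bvec n 1) 1 * (\<Sum>l=i..n. \<phi> (bvec n i) l * skew_coeff n \<theta> l)"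
proof -
  have carr: "\<phi> (bvec n j) \<in> carr (mu0 n)" for j
    using AutD(1)[OF \<phi>] bvec_in_carr by blast
  have low: "\<phi> (bvec n i) l = 0" if "l < i" for l using Aut_mu0_bvec(1)[OF \<phi>, of i l] that i by simp
  have "(\<Sum>l=1..n. \<phi> (bvec n i) l * skew_coeff n \<theta> l) = (\<Sum>l=i..n. \<phi> (bvec n i) l * skew_coeff n \<theta> l)"
    using i low by (intro sum.mono_neutral_right) auto
  then show ?thesis
    using lc_cocycle_skew[OF \<theta> _ carr[of i] carr[of 1]] i low[of 1] by simp
qed

lemma cocycle_equiv_coeffs:
  fixes \<theta> :: "(nat \<Rightarrow> 'f::field) \<Rightarrow> (nat \<Rightarrow> 'f) \<Rightarrow> 'f"
  assumes \<theta>: "lc_cocycle (mu0 n) \<theta>" and eq: "cocycle_equiv (mu0 n) \<theta> \<theta>'" and n: "n \<ge> 2"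
  obtains \<phi> c where "\<phi> \<in> Aut (mu0 n)" "c \<noteq> 0"
    "top_coeff n \<theta>' = c * \<phi> (bvec n 1) 1 ^ (n + 1) * top_coeff n \<theta>"
    "\<And>i. i \<in> {2..n} \<Longrightarrow> skew_coeff n \<theta>' i =
       c * \<phi> (bvec n 1) 1 * (\<Sum>l=i..n. \<phi> (bvec n i) l * skew_coeff n \<theta> l)"
proof -
  obtain \<phi> c f where \<phi>: "\<phi> \<in> Aut (mu0 n)" and c: "c \<noteq> 0" and f: "linear_from (mu0 n) (*) f"
    and \<theta>': "\<And>x y. x \<in> carr (mu0 n) \<Longrightarrow> y \<in> carr (mu0 n) \<Longrightarrow>
      \<theta>' x y = c * \<theta> (\<phi> x) (\<phi> y) + f (mul (mu0 n) x y)"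
    using eq by (auto simp: cocycle_equiv_def)
  have "top_coeff n \<theta>' = c * \<phi> (bvec n 1) 1 ^ (n + 1) * top_coeff n \<theta>"
    using act_top_coeff[OF \<theta> \<phi> n] coboundary_coeffs(1)[OF f] n
    by (simp add: top_coeff_def[of n \<theta>'] \<theta>' bvec_in_carr)
  moreover have "skew_coeff n \<theta>' i =
      c * \<phi> (bvec n 1) 1 * (\<Sum>l=i..n. \<phi> (bvec n i) l * skew_coeff n \<theta> l)" if "i \<in> {2..n}" for i
  proof -
    have "skew_coeff n \<theta>' i = c * (\<theta> (\<phi> (bvec n i)) (\<phi> (bvec n 1)) - \<theta> (\<phi> (bvec n 1)) (\<phi> (bvec n i)))"
      using coboundary_coeffs(2)[OF f, of i] n
      by (simp add: skew_coeff_def[of n \<theta>'] \<theta>' bvec_in_carr right_diff_distrib)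
    then show ?thesis unfolding act_skew_coeff[OF \<theta> \<phi> that] by (simp only: mult.assoc)
  qed
  ultimately show thesis using \<phi> c that by blast
qed

text \<open>
  The difference of \<open>\<theta>'\<close> and the rescaled pull-back of \<open>\<theta>\<close> has vanishing
  coordinates, hence is a coboundary.
\<close>

lemma cocycle_equivI:
  fixes \<theta> :: "(nat \<Rightarrow> 'f::field) \<Rightarrow> (nat \<Rightarrow> 'f) \<Rightarrow> 'f"
  assumes \<theta>: "lc_cocycle (mu0 n) \<theta>" and \<theta>': "lc_cocycle (mu0 n) \<theta>'"
    and \<phi>: "\<phi> \<in> Aut (mu0 n)" and c: "c \<noteq> 0" and n: "n \<ge> 2"
    and top: "top_coeff n \<theta>' = c * \<phi> (bvec n 1) 1 ^ (n + 1) * top_coeff n \<theta>"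
    and skew: "\<And>i. i \<in> {2..n} \<Longrightarrow> skew_coeff n \<theta>' i =
       c * \<phi> (bvec n 1) 1 * (\<Sum>l=i..n. \<phi> (bvec n i) l * skew_coeff n \<theta> l)"
  shows "cocycle_equiv (mu0 n) \<theta> \<theta>'"
proof -
  let ?A = "mu0 n :: ('f, nat \<Rightarrow> 'f) nalg"
  define \<eta> where "\<eta> = (\<lambda>x y. \<theta>' x y - c * \<theta> (\<phi> x) (\<phi> y))"
  have bil: "bilinear_from ?A (*) \<theta>" "bilinear_from ?A (*) \<theta>'"
    using \<theta> \<theta>' by (auto simp: lc_cocycle_def)
  have "bilinear_from ?A (*) \<eta>"
    using bilinear_fromD[OF bil(1)] bilinear_fromD[OF bil(2)] AutD[OF \<phi>]
    by (simp add: bilinear_from_def linear_from_def \<eta>_def algebra_simps del: scl_mu0)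
  then have \<eta>: "lc_cocycle ?A \<eta>"
    using \<theta> \<theta>' AutD[OF \<phi>] by (simp add: lc_cocycle_def \<eta>_def)
  have "top_coeff n \<eta> = 0"
    using act_top_coeff[OF \<theta> \<phi> n] top
    unfolding top_coeff_def[of n \<eta>] top_coeff_def[of n \<theta>'] by (simp add: \<eta>_def)
  moreover have "skew_coeff n \<eta> i = 0" if "i \<in> {2..n}" for i
  proof -
    have "skew_coeff n \<eta> i = skew_coeff n \<theta>' i -
        c * (\<theta> (\<phi> (bvec n i)) (\<phi> (bvec n 1)) - \<theta> (\<phi> (bvec n 1)) (\<phi> (bvec n i)))"
      by (simp add: skew_coeff_def \<eta>_def algebra_simps)
    then show ?thesis using act_skew_coeff[OF \<theta> \<phi> that] skew[OF that] by simp
  qed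
  ultimately obtain f where f: "linear_from ?A (*) f"
    "\<And>x y. x \<in> carr ?A \<Longrightarrow> y \<in> carr ?A \<Longrightarrow> \<eta> x y = f (mul ?A x y)"
    using lc_cocycle_coboundary[OF \<eta>] by blast
  have "\<theta>' x y = c * \<theta> (\<phi> x) (\<phi> y) + f (mul ?A x y)" if "x \<in> carr ?A" "y \<in> carr ?A" for x y
    using f(2)[OF that] by (simp add: \<eta>_def algebra_simps)
  then show ?thesis using \<phi> c f(1) unfolding cocycle_equiv_def by blast
qed

text \<open>
  The annihilator of \<open>mu0 n\<close> is spanned by $e_n$, and the only values of \<open>\<theta>\<close> on pairs
  of basis vectors involving $e_n$ that can be nonzero are $\theta(e_1, e_n)$ and
  $\theta(e_n, e_1)$: the top coefficient and its sum with the last skew coefficient.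
\<close>

lemma Ann_cocycle_mu0_iff:
  fixes \<theta> :: "(nat \<Rightarrow> 'f::field) \<Rightarrow> (nat \<Rightarrow> 'f) \<Rightarrow> 'f"
  assumes \<theta>: "lc_cocycle (mu0 n) \<theta>" and n: "n \<ge> 2"
  shows "Ann_cocycle (mu0 n) \<theta> \<inter> Ann (mu0 n) = {0} \<longleftrightarrow> top_coeff n \<theta> \<noteq> 0 \<or> skew_coeff n \<theta> n \<noteq> 0"
    (is "?I = {0} \<longleftrightarrow> ?R")
proof -
  have bil: "bilinear_from (mu0 n) (*) \<theta>" using \<theta> by (simp add: lc_cocycle_def)
  have zero: "\<theta> (bvec n 1) 0 = 0" using \<theta> by (rule lc_cocycle_zero)
  have en: "bvec n n \<in> Ann (mu0 n :: ('f, _) nalg)" "bvec n n \<noteq> (0 :: nat \<Rightarrow> 'f)"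
    using n by (auto simp: Ann_mu0 bvec_def fun_eq_iff)
  show ?thesis
  proof
    assume I: "?I = {0}"
    show ?R
    proof (rule ccontr)
      assume "\<not> ?R"
      then have top: "top_coeff n \<theta> = 0" and skew: "skew_coeff n \<theta> n = 0" by auto
      have vanish: "\<theta> (bvec n n) (bvec n j) = 0 \<and> \<theta> (bvec n j) (bvec n n) = 0" if j: "j \<in> {1..n}" for j
        using lc_cocycle_bvec[OF \<theta>, of n j] lc_cocycle_bvec[OF \<theta>, of j n] j n top skew zero
        by (cases "j = 1") (auto simp: top_coeff_def bvec_eq_0)
      have "\<theta> (bvec n n) y = 0 \<and> \<theta> y (bvec n n) = 0" if y: "y \<in> carr (mu0 n)" for y
      proof -
        have "linear_from (mu0 n) (*) (\<theta> (bvec n n))" "linear_from (mu0 n) (*) (\<lambda>z. \<theta> z (bvec n n))"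
          using bil bvec_in_carr[of n n] by (auto simp: bilinear_from_def)
        from this[THEN linear_from_mu0_expand, OF y] show ?thesis using vanish by simp
      qed
      then have "bvec n n \<in> ?I" using en(1) bvec_in_carr[of n n] by (simp add: Ann_cocycle_def)
      then show False using I en(2) by blast
    qed
  next
    assume R: ?R
    have "x = 0" if x: "x \<in> ?I" for x
    proof -
      have "x = scl (mu0 n) (x n) (bvec n n)"
        using x n by (auto simp: Ann_mu0 bvec_def fun_eq_iff)
      then have "\<theta> x (bvec n 1) = x n * \<theta> (bvec n n) (bvec n 1)"
          "\<theta> (bvec n 1) x = x n * \<theta> (bvec n 1) (bvec n n)"
        using bilinear_fromD(3,4)[OF bil] bvec_in_carr by metis+
      moreover have "\<theta> x (bvec n 1) = 0" "\<theta> (bvec n 1) x = 0"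
        using x bvec_in_carr[of n 1] by (auto simp: Ann_cocycle_def)
      ultimately have "x n = 0" using R by (auto simp: top_coeff_def skew_coeff_def)
      then show ?thesis using x n by (auto simp: Ann_mu0 fun_eq_iff)
    qed
    moreover have "0 \<in> ?I"
      using algebra_closed(1)[OF algebra_mu0] bilinear_from_zero[OF algebra_mu0 bil] n
      by (simp add: Ann_cocycle_def Ann_mu0)
    ultimately show "?I = {0}" by blast
  qed
qed

lemma not_coboundary_mu0:
  fixes \<theta> :: "(nat \<Rightarrow> 'f::field) \<Rightarrow> (nat \<Rightarrow> 'f) \<Rightarrow> 'f"
  assumes n: "n \<ge> 2" and R: "top_coeff n \<theta> \<noteq> 0 \<or> skew_coeff n \<theta> n \<noteq> 0"
  shows "\<theta> \<notin> B2 (mu0 n) (*)"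
proof
  assume "\<theta> \<in> B2 (mu0 n) (*)"
  then obtain f where f: "linear_from (mu0 n) (*) f" "\<theta> = on_carr (mu0 n) (\<lambda>x y. f (mul (mu0 n) x y))"
    by (auto simp: B2_def)
  have "top_coeff n \<theta> = 0" "skew_coeff n \<theta> n = 0"
    using coboundary_coeffs[OF f(1)] n
    by (simp_all add: top_coeff_def skew_coeff_def f(2) on_carr_def bvec_in_carr)
  then show False using R by simp
qed

text \<open>
  By right commutativity
  $\theta(e_i, e_1) = \theta(e_1 e_{i-1}, e_1) = \theta(e_1 e_1, e_{i-1}) = \theta(e_2, e_{i-1})$. For
  $i \ge 3$ the second index is at least 2, so left commutativity turns this into
  $\theta(e_1, e_i)$.
\<close>

lemma BC_skew_coeff:
  assumes \<theta>: "\<theta> \<in> Z2_BC (mu0 n) (*)" and i: "i \<in> {3..n}"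
  shows "skew_coeff n \<theta> i = 0"
proof -
  have lc: "lc_cocycle (mu0 n) \<theta>" using \<theta> lc_cocycle_Z2[of \<theta> BC] by simp
  have "\<theta> (mul (mu0 n) (bvec n 1) (bvec n (i - 1))) (bvec n 1) =
      \<theta> (mul (mu0 n) (bvec n 1) (bvec n 1)) (bvec n (i - 1))"
    using \<theta> bvec_in_carr unfolding Z2_BC_def by blast
  then have "\<theta> (bvec n i) (bvec n 1) = \<theta> (bvec n 2) (bvec n (i - 1))"
    using i by (simp add: mul_bvec_all numeral_2_eq_2 Suc_le_eq)
  also have "\<dots> = \<theta> (bvec n 1) (bvec n i)"
  proof -
    have "2 \<in> {1..n}" "i - 1 \<in> {1..n}" "i - 1 \<noteq> 1" "2 + (i - 1) - 1 = i" using i by auto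
    then show ?thesis using lc_cocycle_bvec[OF lc, of 2 "i - 1"] by simp
  qed
  finally show ?thesis by (simp add: skew_coeff_def)
qed

section \<open>The representatives\<close>

lemma on_carr_eq_iff: "on_carr A \<theta> = \<theta> \<longleftrightarrow> (\<forall>x y. x \<notin> carr A \<or> y \<notin> carr A \<longrightarrow> \<theta> x y = 0)"
  by (auto simp: on_carr_def fun_eq_iff)

lemma Z2I:
  assumes "bilinear_from A (*) \<theta>" "on_carr A \<theta> = \<theta>"
    and "\<And>x y z. x \<in> carr A \<Longrightarrow> y \<in> carr A \<Longrightarrow> z \<in> carr A \<Longrightarrow> \<theta> x (mul A y z) = \<theta> y (mul A x z)"
    and "\<And>x y z. M = BC \<Longrightarrow> x \<in> carr A \<Longrightarrow> y \<in> carr A \<Longrightarrow> z \<in> carr A \<Longrightarrow>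
      \<theta> (mul A x y) z = \<theta> (mul A x z) y"
  shows "\<theta> \<in> Z2 M A (*)"
  using assms by (cases M) (simp_all add: Z2_LC_def Z2_BC_def Bil_def)

lemma Z2_lincomb:
  assumes "\<theta> \<in> Z2 M A (*)" "\<eta> \<in> Z2 M A (*)"
  shows "\<theta> + bscale (*) c \<eta> \<in> Z2 M A (*)"
proof (rule Z2I)
  have mem: "\<theta> \<in> Z2_LC A (*)" "\<eta> \<in> Z2_LC A (*)" using assms Z2_in_LC by blast+
  note bil = Z2_LC_D(1)[OF mem(1)] Z2_LC_D(1)[OF mem(2)]
  show "bilinear_from A (*) (\<theta> + bscale (*) c \<eta>)"
    using bilinear_fromD[OF bil(1)] bilinear_fromD[OF bil(2)]
    by (simp add: bilinear_from_def linear_from_def bscale_def algebra_simps)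
  show "on_carr A (\<theta> + bscale (*) c \<eta>) = \<theta> + bscale (*) c \<eta>"
    using Z2_LC_D(2)[OF mem(1)] Z2_LC_D(2)[OF mem(2)] by (simp add: on_carr_eq_iff bscale_def)
  fix x y z assume xyz: "x \<in> carr A" "y \<in> carr A" "z \<in> carr A"
  show "(\<theta> + bscale (*) c \<eta>) x (mul A y z) = (\<theta> + bscale (*) c \<eta>) y (mul A x z)"
    using Z2_LC_D(3)[OF mem(1) xyz] Z2_LC_D(3)[OF mem(2) xyz] by (simp add: bscale_def)
  assume "M = BC"
  then have "\<theta> (mul A x y) z = \<theta> (mul A x z) y" "\<eta> (mul A x y) z = \<eta> (mul A x z) y"
    using assms xyz by (simp_all add: Z2_BC_def)
  then show "(\<theta> + bscale (*) c \<eta>) (mul A x y) z = (\<theta> + bscale (*) c \<eta>) (mul A x z) y"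
    by (simp add: bscale_def)
qed

lemma bscale_one: "bscale (*) (1 :: 'f::field) \<theta> = \<theta>"
  by (simp add: bscale_def)

lemma Delta_carr:
  "x \<in> carr (mu0 n) \<Longrightarrow> y \<in> carr (mu0 n) \<Longrightarrow> Delta n i j x y = x i * y j"
  by (simp add: Delta_def on_carr_def)

text \<open>
  A product has no $e_1$-component, which makes both sides of the left identity vanish; the
  $e_2$-component of $xy$ is $x_1 y_1$, which makes $(xy)_2 z_1$ symmetric.
\<close>

lemma Delta_in_Z2:
  fixes M :: variety
  assumes n: "n \<ge> 2" and i: "M = BC \<Longrightarrow> i = 2"
  shows "(Delta n i 1 :: (nat \<Rightarrow> 'f::field) \<Rightarrow> _) \<in> Z2 M (mu0 n) (*)"
proof (rule Z2I)
  let ?A = "mu0 n :: ('f, nat \<Rightarrow> 'f) nalg"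
  note cl = algebra_closed[OF algebra_mu0[of n, where ?'a = 'f]]
  show "bilinear_from ?A (*) (Delta n i 1)"
    using cl(2,3) by (simp add: bilinear_from_def linear_from_def Delta_carr algebra_simps)
  show "on_carr ?A (Delta n i 1) = Delta n i 1"
    by (simp add: on_carr_eq_iff) (simp add: Delta_def on_carr_def)
  fix x y z :: "nat \<Rightarrow> 'f"
  assume xyz: "x \<in> carr ?A" "y \<in> carr ?A" "z \<in> carr ?A"
  have at_1: "mul ?A u v 1 = 0" if "u \<in> carr ?A" "v \<in> carr ?A" for u v
    using that by (simp add: mul_mu0 trunc_fps_def fps_mult_nth carr_mu0_nth_0)
  have at_2: "mul ?A u v 2 = u 1 * v 1" if "u \<in> carr ?A" "v \<in> carr ?A" for u v
    using that n by (simp add: mul_mu0 trunc_fps_def fps_mult_nth carr_mu0_nth_0 numeral_2_eq_2)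
  show "Delta n i 1 x (mul ?A y z) = Delta n i 1 y (mul ?A x z)"
    using xyz cl(4) at_1 by (simp add: Delta_carr)
  assume "M = BC"
  then show "Delta n i 1 (mul ?A x y) z = Delta n i 1 (mul ?A x z) y"
    using xyz cl(4) at_2 i by (simp add: Delta_carr)
qed

lemma sum_apply2: "(\<Sum>k\<in>S. F k) x y = (\<Sum>k\<in>S. F k x y)"
  by (induction S rule: infinite_finite_induct) auto

text \<open>
  The form \<open>nabla n n\<close> is the coefficient of $X^{n+1}$ in the product of power series, the first
  one that multiplication in \<open>mu0 n\<close> forgets.
\<close>

lemma nabla_carr:
  assumes "x \<in> carr (mu0 n)" "y \<in> carr (mu0 n)"
  shows "nabla n n x y = (Abs_fps x * Abs_fps y) $ (n + 1)"
proof -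
  have "nabla n n x y = (\<Sum>k=1..n. x k * y (n + 1 - k))"
    using assms by (simp add: nabla_def sum_apply2 Delta_carr)
  also have "\<dots> = (\<Sum>k=0..n + 1. x k * y (n + 1 - k))"
    using assms by (intro sum.mono_neutral_left) (auto simp: in_carr_mu0)
  finally show ?thesis by (simp add: fps_mult_nth)
qed

text \<open>
  Truncating the inner product does no harm, because \<open>x\<close> has no constant term. The result is
  symmetric in all three arguments, which yields both cocycle identities.
\<close>

lemma nabla_mul:
  assumes x: "x \<in> carr (mu0 n)" and y: "y \<in> carr (mu0 n)" and z: "z \<in> carr (mu0 n)"
  shows "nabla n n x (mul (mu0 n) y z) = (Abs_fps x * (Abs_fps y * Abs_fps z)) $ (n + 1)"
proof -
  let ?m = "mul (mu0 n) y z"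
  have "nabla n n x ?m = (Abs_fps x * Abs_fps ?m) $ (n + 1)"
    using x algebra_closed(4)[OF algebra_mu0 y z] by (rule nabla_carr)
  also have "\<dots> = (\<Sum>i=0..n + 1. x i * ?m (n + 1 - i))" by (simp add: fps_mult_nth)
  also have "\<dots> = (\<Sum>i=0..n + 1. x i * (Abs_fps y * Abs_fps z) $ (n + 1 - i))"
  proof (rule sum.cong[OF refl])
    fix i assume "i \<in> {0..n + 1}"
    show "x i * ?m (n + 1 - i) = x i * (Abs_fps y * Abs_fps z) $ (n + 1 - i)"
      using x y z by (cases "i = 0") (simp_all add: mul_mu0 trunc_fps_nth carr_mu0_nth_0)
  qed
  finally show ?thesis by (simp add: fps_mult_nth[of "Abs_fps x"])
qed

lemma nabla_in_Z2: "(nabla n n :: (nat \<Rightarrow> 'f::field) \<Rightarrow> _) \<in> Z2 M (mu0 n) (*)"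
proof (rule Z2I)
  let ?A = "mu0 n :: ('f, nat \<Rightarrow> 'f) nalg"
  note cl = algebra_closed[OF algebra_mu0[of n, where ?'a = 'f]]
  show "bilinear_from ?A (*) (nabla n n)"
    using cl(2,3)
    by (simp add: bilinear_from_def linear_from_def nabla_carr fps_mult_nth algebra_simps
        sum.distrib sum_distrib_left)
  show "on_carr ?A (nabla n n) = nabla n n"
    unfolding on_carr_eq_iff nabla_def sum_apply2 by (auto simp: Delta_def on_carr_def)
  fix x y z :: "nat \<Rightarrow> 'f"
  assume xyz: "x \<in> carr ?A" "y \<in> carr ?A" "z \<in> carr ?A"
  then show "nabla n n x (mul ?A y z) = nabla n n y (mul ?A x z)"
    by (simp add: nabla_mul mult.left_commute)
  have sym: "nabla n n u v = nabla n n v u" if "u \<in> carr ?A" "v \<in> carr ?A" for u v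
    using that by (simp add: nabla_carr mult.commute)
  show "nabla n n (mul ?A x y) z = nabla n n (mul ?A x z) y"
    using xyz cl(4) sym[of "mul ?A x y" z] sym[of "mul ?A x z" y]
    by (simp add: nabla_mul ac_simps)
qed

lemma nabla_bvec:
  assumes ij: "i \<in> {1..n}" "j \<in> {1..n}"
  shows "nabla n n (bvec n i) (bvec n j) = (if i + j = n + 1 then 1 else (0 :: 'f::field))"
proof -
  have "nabla n n (bvec n i) (bvec n j) =
      (\<Sum>k=1..n. if k = i then (if i + j = n + 1 then 1 else 0) else 0 :: 'f)"
    unfolding nabla_def sum_apply2
  proof (rule sum.cong[OF refl])
    fix k assume k: "k \<in> {1..n}"
    then have "Delta n k (n + 1 - k) (bvec n i) (bvec n j) = (if k = i \<and> n + 1 - k = j then 1 else 0 :: 'f)"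
      using ij by (intro Delta_bvec) auto
    then show "Delta n k (n + 1 - k) (bvec n i) (bvec n j) =
        (if k = i then (if i + j = n + 1 then 1 else 0) else 0 :: 'f)"
      using ij by auto
  qed
  then show ?thesis using ij by simp
qed

lemma coeffs_add:
  "top_coeff n (\<theta> + \<eta>) = top_coeff n \<theta> + top_coeff n \<eta>"
  "skew_coeff n (\<theta> + \<eta>) i = skew_coeff n \<theta> i + skew_coeff n \<eta> i"
  "top_coeff n (bscale (*) c \<theta>) = c * top_coeff n \<theta>"
  "skew_coeff n (bscale (*) c \<theta>) i = c * skew_coeff n \<theta> i"
  by (simp_all add: top_coeff_def skew_coeff_def bscale_def algebra_simps)

lemma coeffs_nabla:
  assumes "n \<ge> 1"
  shows "top_coeff n (nabla n n) = 1" and "i \<in> {1..n} \<Longrightarrow> skew_coeff n (nabla n n) i = 0"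
  using assms by (auto simp: top_coeff_def skew_coeff_def nabla_bvec)

lemma coeffs_Delta:
  assumes "n \<ge> 2" "i \<in> {2..n}"
  shows "top_coeff n (Delta n i 1) = 0"
    and "l \<in> {2..n} \<Longrightarrow> skew_coeff n (Delta n i 1) l = (if l = i then 1 else 0)"
  using assms by (auto simp: top_coeff_def skew_coeff_def Delta_bvec)

lemma LC_list_cases:
  assumes "\<rho> \<in> LC_list n"
  obtains (a) "\<rho> = Delta n n 1"
  | (b) \<mu> where "\<rho> = nabla n n + bscale (*) \<mu> (Delta n n 1)"
  | (c) i where "i \<in> {2..<n}" "\<rho> = nabla n n + Delta n i 1"
  using assms by (fastforce simp: LC_list_def)

lemma BC_list_subset: "n \<ge> 2 \<Longrightarrow> BC_list n \<subseteq> LC_list n"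
proof (cases "n = 2")
  case True
  then show ?thesis by (auto simp: BC_list_def LC_list_def)
next
  case False
  assume "n \<ge> 2"
  have "nabla n n = nabla n n + bscale (*) 0 (Delta n n 1 :: (nat \<Rightarrow> 'a) \<Rightarrow> _)"
    by (simp add: bscale_def fun_eq_iff)
  then have "nabla n n \<in> (LC_list n :: ((nat \<Rightarrow> 'a) \<Rightarrow> _) set)" by (auto simp: LC_list_def)
  moreover have "nabla n n + Delta n 2 1 \<in> (LC_list n :: ((nat \<Rightarrow> 'a) \<Rightarrow> _) set)"
    using False \<open>n \<ge> 2\<close> by (auto simp: LC_list_def)
  ultimately show ?thesis using False by (simp add: BC_list_def)
qed

lemma rep_list_subset: "n \<ge> 2 \<Longrightarrow> rep_list M n \<subseteq> LC_list n"
  using BC_list_subset by (cases M) auto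

lemma rep_list_in_Z2:
  assumes n: "n \<ge> 2" and \<rho>: "\<rho> \<in> rep_list M n"
  shows "\<rho> \<in> Z2 M (mu0 n) (*)"
proof -
  have sum: "nabla n n + bscale (*) c (Delta n i 1) \<in> Z2 M (mu0 n) (*)"
    if "M = BC \<Longrightarrow> i = 2" for c :: 'a and i
    using that n by (intro Z2_lincomb nabla_in_Z2 Delta_in_Z2)
  have sum1: "nabla n n + Delta n i 1 \<in> Z2 M (mu0 n :: ('a, _) nalg) (*)"
    if "M = BC \<Longrightarrow> i = 2" for i
    using sum[OF that, of 1] unfolding bscale_one .
  show ?thesis
  proof (cases M)
    case LC
    then have "\<rho> \<in> LC_list n" using \<rho> by simp
    then show ?thesis
      using LC sum sum1 Delta_in_Z2[OF n, of LC] by (cases rule: LC_list_cases) auto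
  next
    case BC
    then have "\<rho> \<in> BC_list n" using \<rho> by simp
    then show ?thesis
      using BC sum[of 2] sum1[of 2] Delta_in_Z2[OF n, of BC 2] nabla_in_Z2[of n BC]
      by (auto simp: BC_list_def split: if_splits)
  qed
qed

lemma LC_list_nondegenerate:
  assumes n: "n \<ge> 2" and \<rho>: "\<rho> \<in> LC_list n"
  shows "top_coeff n \<rho> \<noteq> 0 \<or> skew_coeff n \<rho> n \<noteq> 0"
  using \<rho> n by (cases rule: LC_list_cases) (simp_all add: coeffs_add coeffs_nabla coeffs_Delta del: One_nat_def)

section \<open>Reduction to normal form\<close>

lemma cocycle_equiv_refl: "cocycle_equiv A \<theta> \<theta>"
  unfolding cocycle_equiv_def
  by (rule bexI[of _ id], rule exI[of _ 1], rule exI[of _ "\<lambda>_. 0"])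
    (simp_all add: linear_from_def Aut_def isomorphism_def)

lemma act_Z2:
  assumes A: "algebra A" and \<phi>: "\<phi> \<in> Aut A" and \<theta>: "\<theta> \<in> Z2 M A (*)"
  shows "act A \<phi> \<theta> \<in> Z2 M A (*)"
proof (rule Z2I)
  have mem: "\<theta> \<in> Z2_LC A (*)" using \<theta> by (rule Z2_in_LC)
  note \<phi>' = AutD[OF \<phi>] and cl = algebra_closed[OF A] and bil = bilinear_fromD[OF Z2_LC_D(1)[OF mem]]
  show "bilinear_from A (*) (act A \<phi> \<theta>)"
    using \<phi>' cl(2,3) bil by (simp add: bilinear_from_def linear_from_def act_def on_carr_def)
  show "on_carr A (act A \<phi> \<theta>) = act A \<phi> \<theta>" by (simp add: act_def on_carr_def fun_eq_iff)
  fix x y z assume xyz: "x \<in> carr A" "y \<in> carr A" "z \<in> carr A"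
  show "act A \<phi> \<theta> x (mul A y z) = act A \<phi> \<theta> y (mul A x z)"
    using xyz \<phi>'(1,2) cl(4) Z2_LC_D(3)[OF mem \<phi>'(1) \<phi>'(1) \<phi>'(1), of x y z]
    by (simp add: act_def on_carr_def)
  assume "M = BC"
  then have "\<theta> (mul A (\<phi> x) (\<phi> y)) (\<phi> z) = \<theta> (mul A (\<phi> x) (\<phi> z)) (\<phi> y)"
    using \<theta> xyz \<phi>'(1) by (simp add: Z2_BC_def)
  then show "act A \<phi> \<theta> (mul A x y) z = act A \<phi> \<theta> (mul A x z) y"
    using xyz \<phi>'(1,2) cl(4) by (simp add: act_def on_carr_def)
qed

lemma cocycle_equiv_act: "\<phi> \<in> Aut A \<Longrightarrow> cocycle_equiv A \<theta> (act A \<phi> \<theta>)"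
  unfolding cocycle_equiv_def
  by (rule bexI[of _ \<phi>], rule exI[of _ 1], rule exI[of _ "\<lambda>_. 0"])
    (simp_all add: linear_from_def act_def on_carr_def)

text \<open>
  The two lowest terms of the binomial expansion: the next exponent is $i + 2 (j - 1)$, beyond
  $i + j - 1$.
\<close>

lemma power_X_plus_monomial_nth:
  fixes c :: "'f::field"
  assumes j: "j \<ge> 2" and l: "l \<le> i + j - 1"
  shows "(fps_X + fps_const c * fps_X ^ j) ^ i $ l =
    (if l = i then 1 else 0) + (if l = i + j - 1 then of_nat i * c else 0)"
  using l
proof (induction i arbitrary: l)
  case 0
  then show ?case using j by auto
next
  case (Suc i)
  let ?P = "fps_X + fps_const c * fps_X ^ j"
  have "?P ^ Suc i = fps_X * ?P ^ i + fps_const c * (fps_X ^ j * ?P ^ i)"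
    by (simp add: algebra_simps)
  then have *: "?P ^ Suc i $ l =
      (if l = 0 then 0 else ?P ^ i $ (l - 1)) + c * (if l < j then 0 else ?P ^ i $ (l - j))"
    by (simp add: fps_X_power_mult_nth)
  show ?case
  proof (cases "l = 0")
    case True
    then show ?thesis using * j by simp
  next
    case False
    have 1: "?P ^ i $ (l - 1) = (if l = Suc i then 1 else 0) + (if l = Suc i + j - 1 then of_nat i * c else 0)"
      using Suc.IH[of "l - 1"] Suc.prems j False by auto
    have 2: "(if l < j then 0 else ?P ^ i $ (l - j)) = (if l = Suc i + j - 1 then 1 else 0)"
    proof (cases "l < j")
      case False
      then show ?thesis using Suc.IH[of "l - j"] Suc.prems j by auto
    qed (use j in auto)
    show ?thesis unfolding * 1 2 using False by (simp add: algebra_simps)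
  qed
qed

text \<open>
  Substituting $X + c X^j$ with $j = m + 1 - k$ maps $e_k$ to $e_k + k c e_m$ up to terms beyond
  $e_m$, and fixes each $e_l$ with $l > k$ up to terms beyond $e_m$. Since \<open>m\<close> is the last index
  of a nonzero skew coefficient, the terms beyond it do not matter.
\<close>

lemma clear_skew_coeff:
  fixes \<theta> :: "(nat \<Rightarrow> 'f::field_char_0) \<Rightarrow> (nat \<Rightarrow> 'f) \<Rightarrow> 'f"
  assumes \<theta>: "\<theta> \<in> Z2_LC (mu0 n) (*)" and km: "2 \<le> k" "k < m" "m \<le> n"
    and m: "skew_coeff n \<theta> m \<noteq> 0" and above: "\<And>l. m < l \<Longrightarrow> l \<le> n \<Longrightarrow> skew_coeff n \<theta> l = 0"
  obtains \<theta>' where "\<theta>' \<in> Z2_LC (mu0 n) (*)" "cocycle_equiv (mu0 n) \<theta> \<theta>'"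
    "top_coeff n \<theta>' = top_coeff n \<theta>" "skew_coeff n \<theta>' k = 0"
    "\<And>l. l \<in> {Suc k..n} \<Longrightarrow> skew_coeff n \<theta>' l = skew_coeff n \<theta> l"
proof
  define j where "j = m + 1 - k"
  \<comment> \<open>Solves $a_k + k c a_m = 0$; characteristic 0 makes the denominator nonzero.\<close>
  define c where "c = - skew_coeff n \<theta> k / (of_nat k * skew_coeff n \<theta> m)"
  define P where "P = fps_X + fps_const c * fps_X ^ j"
  define \<phi> where "\<phi> = subst_map n P"
  have j: "j \<ge> 2" using km by (simp add: j_def)
  have P0: "P $ 0 = 0" and P1: "P $ 1 = 1" using j by (auto simp: P_def)
  have \<phi>: "\<phi> \<in> Aut (mu0 n)" unfolding \<phi>_def using P0 P1 by (intro subst_map_Aut) simp_all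
  have \<theta>2: "\<theta> \<in> Z2 LC (mu0 n) (*)" using \<theta> by simp
  have lc: "lc_cocycle (mu0 n) \<theta>" using \<theta>2 by (rule lc_cocycle_Z2)
  have n: "n \<ge> 2" using km by simp
  have \<phi>_bvec: "\<phi> (bvec n i) l = P ^ i $ l" if "i \<in> {1..n}" "l \<in> {1..n}" for i l
    using that by (simp add: \<phi>_def subst_map_bvec[OF P0] trunc_fps_def)
  have \<phi>11: "\<phi> (bvec n 1) 1 = 1" using \<phi>_bvec[of 1 1] P1 n by simp
  let ?\<theta>' = "act (mu0 n) \<phi> \<theta>"
  show "?\<theta>' \<in> Z2_LC (mu0 n) (*)" using act_Z2[OF algebra_mu0 \<phi> \<theta>2] by simp
  show "cocycle_equiv (mu0 n) \<theta> ?\<theta>'" using \<phi> by (rule cocycle_equiv_act)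
  show "top_coeff n ?\<theta>' = top_coeff n \<theta>"
    using act_top_coeff[OF lc \<phi> n] \<phi>11
    unfolding top_coeff_def[of n ?\<theta>'] by (simp add: act_def on_carr_def bvec_in_carr)
  have skew: "skew_coeff n ?\<theta>' l =
      skew_coeff n \<theta> l + (if l = k then of_nat k * c * skew_coeff n \<theta> m else 0)" if l: "l \<in> {k..n}" for l
  proof -
    have "skew_coeff n ?\<theta>' l = (\<Sum>r=l..n. \<phi> (bvec n l) r * skew_coeff n \<theta> r)"
      using act_skew_coeff[OF lc \<phi>, of l] \<phi>11 l km
      unfolding skew_coeff_def[of n ?\<theta>'] by (simp add: act_def on_carr_def bvec_in_carr)
    also have "\<dots> = (\<Sum>r=l..n. (if r = l then skew_coeff n \<theta> l else 0) +
        (if r = m then (if l = k then of_nat k * c * skew_coeff n \<theta> m else 0) else 0))"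
    proof (rule sum.cong[OF refl])
      fix r assume r: "r \<in> {l..n}"
      show "\<phi> (bvec n l) r * skew_coeff n \<theta> r = (if r = l then skew_coeff n \<theta> l else 0) +
          (if r = m then (if l = k then of_nat k * c * skew_coeff n \<theta> m else 0) else 0)"
      proof (cases "r \<le> m")
        case True
        \<comment> \<open>For $l > k$, the second lowest exponent $l + j - 1 = l + m - k$ exceeds \<open>m\<close>.\<close>
        then have "r \<le> l + j - 1" and top: "r = l + j - 1 \<longleftrightarrow> r = m \<and> l = k"
          using l km by (auto simp: j_def)
        then have "\<phi> (bvec n l) r = (if r = l then 1 else 0) + (if r = m \<and> l = k then of_nat l * c else 0)"
          using \<phi>_bvec[of l r] power_X_plus_monomial_nth[OF j, of r l c] l r km by (simp add: P_def)
        then show ?thesis using km by auto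
      next
        case False
        then show ?thesis using above[of r] r by auto
      qed
    qed
    also have "\<dots> = skew_coeff n \<theta> l + (if l = k then of_nat k * c * skew_coeff n \<theta> m else 0)"
      using l km by (auto simp: sum.distrib)
    finally show ?thesis .
  qed
  have "of_nat k * c * skew_coeff n \<theta> m = - skew_coeff n \<theta> k"
    using m km by (simp add: c_def)
  then show "skew_coeff n ?\<theta>' k = 0" using skew[of k] km by simp
  show "skew_coeff n ?\<theta>' l = skew_coeff n \<theta> l" if "l \<in> {Suc k..n}" for l
    using skew[of l] that by simp
qed

text \<open>
  The coefficients are cleared in descending order, because each step may disturb those at smaller
  indices.
\<close>

lemma clear_skew_coeffs:
  fixes \<theta> :: "(nat \<Rightarrow> 'f::field_char_0) \<Rightarrow> (nat \<Rightarrow> 'f) \<Rightarrow> 'f"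
  assumes \<theta>: "\<theta> \<in> Z2_LC (mu0 n) (*)" and m: "2 \<le> m" "m \<le> n" "skew_coeff n \<theta> m \<noteq> 0"
    and above: "\<And>l. m < l \<Longrightarrow> l \<le> n \<Longrightarrow> skew_coeff n \<theta> l = 0"
  obtains \<theta>' where "\<theta>' \<in> Z2_LC (mu0 n) (*)" "cocycle_equiv (mu0 n) \<theta> \<theta>'"
    "top_coeff n \<theta>' = top_coeff n \<theta>"
    "\<And>l. l \<in> {2..n} \<Longrightarrow> skew_coeff n \<theta>' l = (if l = m then skew_coeff n \<theta> m else 0)"
proof -
  have "\<exists>\<theta>'\<in>Z2_LC (mu0 n) (*). cocycle_equiv (mu0 n) \<theta> \<theta>' \<and> top_coeff n \<theta>' = top_coeff n \<theta> \<and>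
    (\<forall>l\<in>{2..n}. skew_coeff n \<theta>' l = (if l = m then skew_coeff n \<theta> m else 0))"
    using m(1)
  proof (induction rule: inc_induct)
    case base
    have "skew_coeff n \<theta> l = (if l = m then skew_coeff n \<theta> m else 0)" if "l \<in> {m..n}" for l
      using above that by auto
    then show ?case using \<theta> cocycle_equiv_refl by blast
  next
    case (step k)
    then obtain \<eta> where \<eta>: "\<eta> \<in> Z2_LC (mu0 n) (*)" "cocycle_equiv (mu0 n) \<theta> \<eta>"
      "top_coeff n \<eta> = top_coeff n \<theta>"
      "\<And>l. l \<in> {Suc k..n} \<Longrightarrow> skew_coeff n \<eta> l = (if l = m then skew_coeff n \<theta> m else 0)"
      by blast
    have "skew_coeff n \<eta> m \<noteq> 0" "\<And>l. m < l \<Longrightarrow> l \<le> n \<Longrightarrow> skew_coeff n \<eta> l = 0"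
      using \<eta>(4) step.hyps m by auto
    then obtain \<theta>' where \<theta>': "\<theta>' \<in> Z2_LC (mu0 n) (*)" "cocycle_equiv (mu0 n) \<eta> \<theta>'"
      "top_coeff n \<theta>' = top_coeff n \<eta>" "skew_coeff n \<theta>' k = 0"
      "\<And>l. l \<in> {Suc k..n} \<Longrightarrow> skew_coeff n \<theta>' l = skew_coeff n \<eta> l"
      using clear_skew_coeff[OF \<eta>(1) step.hyps(1,2) m(2)] by blast
    have "cocycle_equiv (mu0 n) \<theta> \<theta>'"
      using cocycle_equiv_trans[OF \<eta>(2) \<theta>'(2) algebra_mu0] .
    moreover have "skew_coeff n \<theta>' l = (if l = m then skew_coeff n \<theta> m else 0)" if "l \<in> {k..n}" for l
      using that \<theta>'(4,5) \<eta>(4) step.hyps by (cases "l = k") auto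
    ultimately show ?case using \<theta>'(1,3) \<eta>(3) by auto
  qed
  then show thesis using that by blast
qed

lemma cocycle_equiv_scaling:
  fixes \<theta> :: "(nat \<Rightarrow> 'f::field) \<Rightarrow> (nat \<Rightarrow> 'f) \<Rightarrow> 'f"
  assumes \<theta>: "lc_cocycle (mu0 n) \<theta>" and \<theta>': "lc_cocycle (mu0 n) \<theta>'" and n: "n \<ge> 2"
    and c: "c \<noteq> 0" and d: "d \<noteq> 0"
    and top: "top_coeff n \<theta>' = c * d ^ (n + 1) * top_coeff n \<theta>"
    and skew: "\<And>i. i \<in> {2..n} \<Longrightarrow> skew_coeff n \<theta>' i = c * d ^ (i + 1) * skew_coeff n \<theta> i"
  shows "cocycle_equiv (mu0 n) \<theta> \<theta>'"
proof -
  define P where "P = fps_const d * fps_X"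
  have P0: "P $ 0 = 0" by (simp add: P_def)
  have \<phi>: "subst_map n P \<in> Aut (mu0 n)" using d by (intro subst_map_Aut) (simp_all add: P_def)
  have val: "subst_map n P (bvec n i) l = (if l = i then d ^ i else 0)" if "i \<in> {1..n}" for i l
    using that by (simp only: subst_map_bvec[OF P0])
      (auto simp: trunc_fps_def P_def power_mult_distrib fps_const_power)
  have "(\<Sum>l=i..n. subst_map n P (bvec n i) l * skew_coeff n \<theta> l) = d ^ i * skew_coeff n \<theta> i"
    if i: "i \<in> {2..n}" for i
  proof -
    have "(\<Sum>l=i..n. subst_map n P (bvec n i) l * skew_coeff n \<theta> l) =
        (\<Sum>l=i..n. if l = i then d ^ i * skew_coeff n \<theta> i else 0)"
      using i by (intro sum.cong) (auto simp: val)
    then show ?thesis using i by simp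
  qed
  then show ?thesis
    using n top skew val[of 1 1]
    by (intro cocycle_equivI[OF \<theta> \<theta>' \<phi> c n]) (simp_all add: mult.assoc)
qed

section \<open>Classification of the orbits\<close>

lemma equiv_Delta_top:
  fixes \<theta> :: "(nat \<Rightarrow> 'f::field_char_0) \<Rightarrow> (nat \<Rightarrow> 'f) \<Rightarrow> 'f"
  assumes \<theta>: "\<theta> \<in> Z2_LC (mu0 n) (*)" and n: "n \<ge> 2"
    and top: "top_coeff n \<theta> = 0" and m: "skew_coeff n \<theta> n \<noteq> 0"
  shows "cocycle_equiv (mu0 n) \<theta> (Delta n n 1)"
proof -
  obtain \<eta> where \<eta>: "\<eta> \<in> Z2_LC (mu0 n) (*)" "cocycle_equiv (mu0 n) \<theta> \<eta>"
    "top_coeff n \<eta> = top_coeff n \<theta>"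
    "\<And>l. l \<in> {2..n} \<Longrightarrow> skew_coeff n \<eta> l = (if l = n then skew_coeff n \<theta> n else 0)"
    using clear_skew_coeffs[OF \<theta> n order_refl m] by auto
  have "cocycle_equiv (mu0 n) \<eta> (Delta n n 1)"
  proof (rule cocycle_equiv_scaling[where c = "1 / skew_coeff n \<theta> n" and d = 1])
    show "lc_cocycle (mu0 n) \<eta>" using lc_cocycle_Z2[of \<eta> LC] \<eta>(1) by simp
    show "lc_cocycle (mu0 n) (Delta n n 1)" using Delta_in_Z2[OF n, of LC n] by (intro lc_cocycle_Z2[of _ LC]) auto
  qed (use n m top \<eta> in \<open>simp_all add: coeffs_Delta del: One_nat_def\<close>)
  then show ?thesis using cocycle_equiv_trans[OF \<eta>(2) _ algebra_mu0] by blast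
qed

lemma equiv_nabla_Delta_top:
  fixes \<theta> :: "(nat \<Rightarrow> 'f::field_char_0) \<Rightarrow> (nat \<Rightarrow> 'f) \<Rightarrow> 'f"
  assumes \<theta>: "\<theta> \<in> Z2_LC (mu0 n) (*)" and n: "n \<ge> 2"
    and top: "top_coeff n \<theta> \<noteq> 0"
    and m: "skew_coeff n \<theta> n \<noteq> 0 \<or> (\<forall>l\<in>{2..n}. skew_coeff n \<theta> l = 0)"
  shows "cocycle_equiv (mu0 n) \<theta>
    (nabla n n + bscale (*) (skew_coeff n \<theta> n / top_coeff n \<theta>) (Delta n n 1))"
proof -
  obtain \<eta> where \<eta>: "\<eta> \<in> Z2_LC (mu0 n) (*)" "cocycle_equiv (mu0 n) \<theta> \<eta>"
    "top_coeff n \<eta> = top_coeff n \<theta>"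
    "\<And>l. l \<in> {2..n} \<Longrightarrow> skew_coeff n \<eta> l = (if l = n then skew_coeff n \<theta> n else 0)"
  proof (cases "skew_coeff n \<theta> n = 0")
    case True
    then show ?thesis using that[OF \<theta> cocycle_equiv_refl] m by auto
  next
    case False
    then show ?thesis using clear_skew_coeffs[OF \<theta> n order_refl False] that by auto
  qed
  have "cocycle_equiv (mu0 n) \<eta>
    (nabla n n + bscale (*) (skew_coeff n \<theta> n / top_coeff n \<theta>) (Delta n n 1))"
  proof (rule cocycle_equiv_scaling[where c = "1 / top_coeff n \<theta>" and d = 1])
    show "lc_cocycle (mu0 n) \<eta>" using lc_cocycle_Z2[of \<eta> LC] \<eta>(1) by simp
    show "lc_cocycle (mu0 n) (nabla n n + bscale (*) (skew_coeff n \<theta> n / top_coeff n \<theta>) (Delta n n 1))"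
      by (rule lc_cocycle_Z2[of _ LC], rule Z2_lincomb, rule nabla_in_Z2, rule Delta_in_Z2[OF n]) auto
  qed (use n top \<eta> in \<open>simp_all add: coeffs_add coeffs_nabla coeffs_Delta del: One_nat_def\<close>)
  then show ?thesis using cocycle_equiv_trans[OF \<eta>(2) _ algebra_mu0] by blast
qed

text \<open>
  Once all other skew coefficients are cleared, the substitution of $d X$ multiplies $a_m / t$ by
  $d^{m-n}$. As $m < n$, a root \<open>d\<close> of $a_m / t$ of order $n - m$ makes the ratio 1.
\<close>

lemma equiv_nabla_Delta:
  fixes \<theta> :: "(nat \<Rightarrow> 'f::{alg_closed_field, field_char_0}) \<Rightarrow> (nat \<Rightarrow> 'f) \<Rightarrow> 'f"
  assumes \<theta>: "\<theta> \<in> Z2_LC (mu0 n) (*)" and m: "m \<in> {2..<n}"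
    and top: "top_coeff n \<theta> \<noteq> 0" and skew: "skew_coeff n \<theta> m \<noteq> 0"
    and above: "\<And>l. m < l \<Longrightarrow> l \<le> n \<Longrightarrow> skew_coeff n \<theta> l = 0"
  shows "cocycle_equiv (mu0 n) \<theta> (nabla n n + Delta n m 1)"
proof -
  have n: "n \<ge> 2" and m': "2 \<le> m" "m \<le> n" using m by auto
  obtain \<eta> where \<eta>: "\<eta> \<in> Z2_LC (mu0 n) (*)" "cocycle_equiv (mu0 n) \<theta> \<eta>"
    "top_coeff n \<eta> = top_coeff n \<theta>"
    "\<And>l. l \<in> {2..n} \<Longrightarrow> skew_coeff n \<eta> l = (if l = m then skew_coeff n \<theta> m else 0)"
    using clear_skew_coeffs[OF \<theta> m' skew above] by auto
  obtain d where d: "d ^ (n - m) = skew_coeff n \<theta> m / top_coeff n \<theta>"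
    using nth_root_exists[of "n - m"] m by auto
  then have d0: "d \<noteq> 0" using top skew m by (auto simp: power_0_left)
  have "d ^ (n + 1) = d ^ (n - m) * d ^ (m + 1)" using m by (simp flip: power_add)
  then have dn: "d ^ (n + 1) * top_coeff n \<theta> = d ^ (m + 1) * skew_coeff n \<theta> m"
    using d top by (simp add: field_simps)
  have "cocycle_equiv (mu0 n) \<eta> (nabla n n + Delta n m 1)"
  proof (rule cocycle_equiv_scaling[where c = "1 / (d ^ (n + 1) * top_coeff n \<theta>)" and d = d])
    show "lc_cocycle (mu0 n) \<eta>" using lc_cocycle_Z2[of \<eta> LC] \<eta>(1) by simp
    have "nabla n n + bscale (*) 1 (Delta n m 1) \<in> Z2 LC (mu0 n :: ('f, _) nalg) (*)"
      by (rule Z2_lincomb, rule nabla_in_Z2, rule Delta_in_Z2[OF n]) auto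
    then show "lc_cocycle (mu0 n) (nabla n n + Delta n m 1 :: (nat \<Rightarrow> 'f) \<Rightarrow> _)"
      unfolding bscale_one by (rule lc_cocycle_Z2)
    show "1 / (d ^ (n + 1) * top_coeff n \<theta>) \<noteq> 0" using d0 top by simp
    show "top_coeff n (nabla n n + Delta n m 1) =
        1 / (d ^ (n + 1) * top_coeff n \<theta>) * d ^ (n + 1) * top_coeff n \<eta>"
      using n m' d0 top \<eta>(3) by (simp add: coeffs_add coeffs_nabla coeffs_Delta del: One_nat_def)
    show "skew_coeff n (nabla n n + Delta n m 1) i =
        1 / (d ^ (n + 1) * top_coeff n \<theta>) * d ^ (i + 1) * skew_coeff n \<eta> i" if i: "i \<in> {2..n}" for i
    proof -
      have "skew_coeff n (nabla n n + Delta n m 1) i = (if i = m then 1 else 0 :: 'f)"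
        using n m' i by (simp add: coeffs_add coeffs_nabla coeffs_Delta del: One_nat_def)
      also have "\<dots> = 1 / (d ^ (n + 1) * top_coeff n \<theta>) * d ^ (i + 1) * skew_coeff n \<eta> i"
        unfolding dn using \<eta>(4)[OF i] d0 skew by simp
      finally show ?thesis .
    qed
  qed (use n d0 in auto)
  then show ?thesis using cocycle_equiv_trans[OF \<eta>(2) _ algebra_mu0] by blast
qed

lemma exists_LC_representative:
  fixes \<theta> :: "(nat \<Rightarrow> 'f::{alg_closed_field, field_char_0}) \<Rightarrow> (nat \<Rightarrow> 'f) \<Rightarrow> 'f"
  assumes \<theta>: "\<theta> \<in> Z2_LC (mu0 n) (*)" and n: "n \<ge> 2"
    and nondeg: "top_coeff n \<theta> \<noteq> 0 \<or> skew_coeff n \<theta> n \<noteq> 0"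
  shows "\<exists>\<rho>\<in>LC_list n. cocycle_equiv (mu0 n) \<theta> \<rho>"
proof (cases "top_coeff n \<theta> = 0")
  case True
  then show ?thesis
    using equiv_Delta_top[OF \<theta> n True] nondeg by (auto simp: LC_list_def)
next
  case top: False
  show ?thesis
  proof (cases "skew_coeff n \<theta> n \<noteq> 0 \<or> (\<forall>l\<in>{2..n}. skew_coeff n \<theta> l = 0)")
    case True
    then show ?thesis
      using equiv_nabla_Delta_top[OF \<theta> n top True] unfolding LC_list_def by blast
  next
    case False
    define S where "S = {l \<in> {2..n}. skew_coeff n \<theta> l \<noteq> 0}"
    have S: "finite S" "S \<noteq> {}" using False by (auto simp: S_def)
    define m where "m = Max S"
    have "m \<in> S" using S by (simp add: m_def)
    moreover have above: "skew_coeff n \<theta> l = 0" if "m < l" "l \<le> n" for l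
      using Max_ge[OF S(1), of l] that \<open>m \<in> S\<close> unfolding m_def[symmetric] by (force simp: S_def)
    ultimately have m: "m \<in> {2..<n}" "skew_coeff n \<theta> m \<noteq> 0"
      using False by (auto simp: S_def less_le)
    have "nabla n n + Delta n m 1 \<in> (LC_list n :: ((nat \<Rightarrow> 'f) \<Rightarrow> _) set)"
      using m by (auto simp: LC_list_def)
    then show ?thesis using equiv_nabla_Delta[OF \<theta> m(1) top m(2) above] by blast
  qed
qed

text \<open>
  A bicommutative cocycle for $n > 2$ can only have the second skew coefficient. As $2 < n$, the top
  coefficient is then nonzero and two of the left commutative representatives remain.
\<close>

lemma exists_representative:
  fixes \<theta> :: "(nat \<Rightarrow> 'f::{alg_closed_field, field_char_0}) \<Rightarrow> (nat \<Rightarrow> 'f) \<Rightarrow> 'f"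
  assumes \<theta>: "\<theta> \<in> Z2 M (mu0 n) (*)" and n: "n \<ge> 2"
    and nondeg: "top_coeff n \<theta> \<noteq> 0 \<or> skew_coeff n \<theta> n \<noteq> 0"
  shows "\<exists>\<rho>\<in>rep_list M n. cocycle_equiv (mu0 n) \<theta> \<rho>"
proof -
  have LC: "\<theta> \<in> Z2_LC (mu0 n) (*)" using \<theta> by (rule Z2_in_LC)
  show ?thesis
  proof (cases "M = LC \<or> n = 2")
    case True
    have "rep_list M n = (LC_list n :: ((nat \<Rightarrow> 'f) \<Rightarrow> _) set)"
      using True by (cases M) (auto simp: BC_list_def LC_list_def)
    then show ?thesis using exists_LC_representative[OF LC n nondeg] by simp
  next
    case False
    then have BC: "M = BC" and n: "n > 2" using n by (cases M; simp)+
    have skew: "skew_coeff n \<theta> l = 0" if "3 \<le> l" "l \<le> n" for l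
      using BC_skew_coeff[of \<theta> n l] \<theta> BC that by simp
    then have top: "top_coeff n \<theta> \<noteq> 0" using nondeg n by auto
    show ?thesis
    proof (cases "skew_coeff n \<theta> 2 = 0")
      case True
      have "skew_coeff n \<theta> l = 0" if "l \<in> {2..n}" for l
        using True skew[of l] that by (cases "l = 2") auto
      then have "cocycle_equiv (mu0 n) \<theta> (nabla n n + bscale (*) 0 (Delta n n 1))"
        using equiv_nabla_Delta_top[OF LC _ top] n by simp
      moreover have "nabla n n + bscale (*) 0 (Delta n n 1) = (nabla n n :: (nat \<Rightarrow> 'f) \<Rightarrow> _)"
        by (simp add: bscale_def fun_eq_iff)
      ultimately show ?thesis using BC n by (auto simp: BC_list_def)
    next
      case False
      then have "cocycle_equiv (mu0 n) \<theta> (nabla n n + Delta n 2 1)"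
        using n skew by (intro equiv_nabla_Delta[OF LC _ top]) auto
      then show ?thesis using BC n by (auto simp: BC_list_def)
    qed
  qed
qed

text \<open>
  Equivalence multiplies the top coefficient by $a c^{n+1}$ and the last nonzero skew coefficient, at
  index \<open>m\<close>, by $a c^{m+1}$, where \<open>a\<close> is the scalar and \<open>c\<close> the leading coefficient of the
  automorphism. So vanishing of the top coefficient, the index \<open>m\<close>, if any, and, for $m = n$, the ratio of
  the two coefficients are invariants, and they separate the list.
\<close>

lemma representatives_inequivalent:
  fixes \<rho> \<rho>' :: "(nat \<Rightarrow> 'f::field) \<Rightarrow> (nat \<Rightarrow> 'f) \<Rightarrow> 'f"
  assumes n: "n \<ge> 2" and \<rho>: "\<rho> \<in> LC_list n" and \<rho>': "\<rho>' \<in> LC_list n"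
    and eq: "cocycle_equiv (mu0 n) \<rho> \<rho>'"
  shows "\<rho> = \<rho>'"
proof -
  have lc: "lc_cocycle (mu0 n) \<rho>"
    using rep_list_in_Z2[OF n, of \<rho> LC] \<rho> by (intro lc_cocycle_Z2[of _ LC]) simp
  obtain \<phi> a where \<phi>: "\<phi> \<in> Aut (mu0 n)" and a: "a \<noteq> 0"
    and top: "top_coeff n \<rho>' = a * \<phi> (bvec n 1) 1 ^ (n + 1) * top_coeff n \<rho>"
    and skew: "\<And>i. i \<in> {2..n} \<Longrightarrow> skew_coeff n \<rho>' i =
       a * \<phi> (bvec n 1) 1 * (\<Sum>l=i..n. \<phi> (bvec n i) l * skew_coeff n \<rho> l)"
    using cocycle_equiv_coeffs[OF lc eq n] by blast
  define c where "c = \<phi> (bvec n 1) 1"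
  have c: "c \<noteq> 0" using Aut_mu0_lead_nonzero[OF \<phi>] n by (simp add: c_def)
  \<comment> \<open>Later skew coefficients being 0, only the diagonal entry $c^i$ of the automorphism counts.\<close>
  have skew_last: "skew_coeff n \<rho>' i = a * c ^ (i + 1) * skew_coeff n \<rho> i"
    if i: "i \<in> {2..n}" and above: "\<And>l. l \<in> {i<..n} \<Longrightarrow> skew_coeff n \<rho> l = 0" for i
  proof -
    have "(\<Sum>l=i..n. \<phi> (bvec n i) l * skew_coeff n \<rho> l) =
        (\<Sum>l=i..n. if l = i then c ^ i * skew_coeff n \<rho> i else 0)"
      using i above Aut_mu0_bvec(2)[OF \<phi>, of i] by (intro sum.cong) (auto simp: c_def)
    then show ?thesis using skew[OF i] i by (simp add: c_def)
  qed
  have top: "top_coeff n \<rho>' = a * c ^ (n + 1) * top_coeff n \<rho>"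
    and skew_n: "skew_coeff n \<rho>' n = a * c ^ (n + 1) * skew_coeff n \<rho> n"
    using top skew_last[of n] n by (simp_all add: c_def)
  note coeffs = coeffs_add coeffs_nabla coeffs_Delta
  show ?thesis
    using \<rho>
  proof (cases rule: LC_list_cases)
    case a
    with top n have zero: "top_coeff n \<rho>' = 0" by (simp add: coeffs del: One_nat_def)
    show ?thesis
      using \<rho>'
    proof (cases rule: LC_list_cases)
    qed (use zero n a in \<open>simp_all add: coeffs del: One_nat_def\<close>)
  next
    case (b \<mu>)
    show ?thesis
      using \<rho>'
    proof (cases rule: LC_list_cases)
      case a
      then show ?thesis using top b n \<open>a \<noteq> 0\<close> c by (simp add: coeffs del: One_nat_def)
    next
      case b': (b \<mu>')
      have "a * c ^ (n + 1) = 1" using top b b' n by (simp add: coeffs del: One_nat_def)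
      then have "\<mu>' = \<mu>" using skew_n b b' n by (simp add: coeffs del: One_nat_def)
      then show ?thesis using b b' by simp
    next
      case (c i)
      have "\<mu> = 0" using skew_n b c n \<open>a \<noteq> 0\<close> \<open>c \<noteq> 0\<close> by (simp add: coeffs del: One_nat_def)
      then have "skew_coeff n \<rho> l = 0" if "l \<in> {2..n}" for l
        using b that n by (simp add: coeffs del: One_nat_def)
      then have "skew_coeff n \<rho>' i = 0" using skew[of i] c by simp
      then show ?thesis using c n by (simp add: coeffs del: One_nat_def)
    qed
  next
    case c\<rho>: (c i)
    have i: "i \<in> {2..n}" "i < n" using c\<rho> by auto
    have \<rho>_skew: "skew_coeff n \<rho> l = (if l = i then 1 else 0)" if "l \<in> {2..n}" for l
      using that c\<rho> i n by (simp add: coeffs del: One_nat_def)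
    have \<rho>'_i: "skew_coeff n \<rho>' i \<noteq> 0" using skew_last[of i] \<rho>_skew i \<open>a \<noteq> 0\<close> c by simp
    have "skew_coeff n \<rho>' n = 0" using skew_n \<rho>_skew i n by simp
    have top: "top_coeff n \<rho>' \<noteq> 0" using top \<open>a \<noteq> 0\<close> c c\<rho> i n by (simp add: coeffs del: One_nat_def)
    show ?thesis
      using \<rho>'
    proof (cases rule: LC_list_cases)
      case a
      then show ?thesis using top n by (simp add: coeffs del: One_nat_def)
    next
      case (b \<mu>)
      then show ?thesis using \<rho>'_i i n by (simp add: coeffs del: One_nat_def)
    next
      case (c i')
      then have "i = i'" using \<rho>'_i i n by (simp add: coeffs split: if_splits del: One_nat_def)
      then show ?thesis using c c\<rho> by simp
    qed
  qed
qed

text \<open>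
  The coefficient line becomes the line of $e_{n+1}$.
\<close>

lemma isomorphic_ext_nabla_mu0:
  fixes n :: nat
  shows "isomorphic (ext (mu0 n) (*) (nabla n n)) (mu0 (n + 1) :: ('f::field, nat \<Rightarrow> 'f) nalg)"
proof -
  let ?E = "ext (mu0 n) (*) (nabla n n) :: ('f, (nat \<Rightarrow> 'f) \<times> 'f) nalg" and ?B = "mu0 (n + 1) :: ('f, nat \<Rightarrow> 'f) nalg"
  define \<Phi> :: "(nat \<Rightarrow> 'f) \<times> 'f \<Rightarrow> nat \<Rightarrow> 'f" where "\<Phi> = (\<lambda>(x, v). x(n + 1 := v))"
  have carr: "\<Phi> p \<in> carr ?B" if "p \<in> carr ?E" for p
    using that by (auto simp: \<Phi>_def in_carr_mu0)
  have bij: "bij_betw \<Phi> (carr ?E) (carr ?B)"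
  proof (rule bij_betw_byWitness[where f' = "\<lambda>y. (y(n + 1 := 0), y (n + 1))"])
    show "\<forall>p\<in>carr ?E. ((\<Phi> p)(n + 1 := 0), \<Phi> p (n + 1)) = p"
      by (auto simp: \<Phi>_def in_carr_mu0 fun_eq_iff)
    show "\<Phi> ` carr ?E \<subseteq> carr ?B" using carr by auto
  qed (auto simp: \<Phi>_def in_carr_mu0)
  have "\<Phi> (mul ?E p q) = mul ?B (\<Phi> p) (\<Phi> q)" if p: "p \<in> carr ?E" and q: "q \<in> carr ?E" for p q
  proof
    fix k
    obtain x v y w where pq: "p = (x, v)" "q = (y, w)" by force
    have x: "x \<in> carr (mu0 n)" and y: "y \<in> carr (mu0 n)" using p q pq by auto
    have ends: "x 0 = 0" "y 0 = 0" "x (n + 1) = 0" "y (n + 1) = 0" using x y by (auto simp: in_carr_mu0)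
    have prod: "(Abs_fps (\<Phi> p) * Abs_fps (\<Phi> q)) $ k = (Abs_fps x * Abs_fps y) $ k" if "k \<le> n + 1"
      unfolding fps_mult_nth
    proof (rule sum.cong[OF refl])
      fix i assume i: "i \<in> {0..k}"
      show "Abs_fps (\<Phi> p) $ i * Abs_fps (\<Phi> q) $ (k - i) = Abs_fps x $ i * Abs_fps y $ (k - i)"
        using that i ends by (cases "i = 0"; cases "k - i = 0") (auto simp: \<Phi>_def pq)
    qed
    show "\<Phi> (mul ?E p q) k = mul ?B (\<Phi> p) (\<Phi> q) k"
      unfolding mul_mu0[OF carr[OF p] carr[OF q]]
      using prod x y ends
      by (auto simp: pq \<Phi>_def nabla_carr mul_mu0[OF x y] trunc_fps_def)
  qed
  moreover have "linear_from ?E (scl ?B) \<Phi>"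
    by (auto simp: linear_from_def \<Phi>_def fun_eq_iff)
  ultimately show ?thesis using bij unfolding isomorphic_def isomorphism_def by blast
qed

section \<open>The classification theorem\<close>

lemma rep_list_admissible:
  assumes n: "n \<ge> 2" and \<rho>: "\<rho> \<in> rep_list M n"
  shows "Ann_cocycle (mu0 n) \<rho> \<inter> Ann (mu0 n) = {0}" and "\<rho> \<notin> B2 (mu0 n) (*)"
proof -
  have R: "top_coeff n \<rho> \<noteq> 0 \<or> skew_coeff n \<rho> n \<noteq> 0"
    using LC_list_nondegenerate[OF n] rep_list_subset[OF n] \<rho> by blast
  then show "\<rho> \<notin> B2 (mu0 n) (*)" by (rule not_coboundary_mu0[OF n])
  show "Ann_cocycle (mu0 n) \<rho> \<inter> Ann (mu0 n) = {0}"
    using R Ann_cocycle_mu0_iff[OF lc_cocycle_Z2[OF rep_list_in_Z2[OF n \<rho>]] n] by blast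
qed

lemma exists_representative_Ann:
  fixes \<theta> :: "(nat \<Rightarrow> 'f::{alg_closed_field, field_char_0}) \<Rightarrow> (nat \<Rightarrow> 'f) \<Rightarrow> 'f"
  assumes "\<theta> \<in> Z2 M (mu0 n) (*)" "n \<ge> 2" "Ann_cocycle (mu0 n) \<theta> \<inter> Ann (mu0 n) = {0}"
  shows "\<exists>\<rho>\<in>rep_list M n. cocycle_equiv (mu0 n) \<theta> \<rho>"
  using assms exists_representative Ann_cocycle_mu0_iff lc_cocycle_Z2 by blast

lemma rep_list_parameterizes_orbits:
  assumes n: "n \<ge> 2"
  shows "parameterizes_orbits M (mu0 n)
    (rep_list M n :: ((nat \<Rightarrow> 'f::{alg_closed_field, field_char_0}) \<Rightarrow> _) set)"
  unfolding parameterizes_orbits_def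
proof (intro conjI ballI)
  let ?A = "mu0 n :: ('f, nat \<Rightarrow> 'f) nalg"
  fix \<rho> :: "(nat \<Rightarrow> 'f) \<Rightarrow> (nat \<Rightarrow> 'f) \<Rightarrow> 'f"
  assume \<rho>: "\<rho> \<in> rep_list M n"
  show Z2: "\<rho> \<in> Z2 M ?A (*)" using n \<rho> by (rule rep_list_in_Z2)
  have "cls ?A (*) \<rho> \<in> H2 M ?A (*) - {B2 ?A (*)}"
    using Z2 rep_list_admissible(2)[OF n \<rho>] by (auto simp: H2_def cls_eq_B2_iff)
  then have "cocycle_line ?A \<rho> \<in> G1 M ?A (*)" by (auto simp: G1_def cocycle_line_def)
  then show "cocycle_line ?A \<rho> \<in> T1 M ?A"
    using Z2 rep_list_admissible(1)[OF n \<rho>] unfolding T1_def by blast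
next
  let ?A = "mu0 n :: ('f, nat \<Rightarrow> 'f) nalg"
  fix X assume "X \<in> orbit ?A ` T1 M ?A"
  then obtain \<theta> where \<theta>: "\<theta> \<in> Z2 M ?A (*)" "Ann_cocycle ?A \<theta> \<inter> Ann ?A = {0}"
    and X: "X = orbit ?A (cocycle_line ?A \<theta>)"
    by (auto simp: T1_def)
  have mem: "cocycle_line ?A \<rho> \<in> X \<longleftrightarrow> cocycle_equiv ?A \<theta> \<rho>" if "\<rho> \<in> rep_list M n" for \<rho>
    unfolding X using Z2_LC_D(2)[OF Z2_in_LC[OF rep_list_in_Z2[OF n that]]] rep_list_admissible(2)[OF n that]
    by (rule cocycle_line_in_orbit_iff[OF algebra_mu0])
  obtain \<rho> where \<rho>: "\<rho> \<in> rep_list M n" "cocycle_equiv ?A \<theta> \<rho>"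
    using exists_representative_Ann[OF \<theta>(1) n \<theta>(2)] by blast
  show "\<exists>!\<rho>. \<rho> \<in> rep_list M n \<and> cocycle_line ?A \<rho> \<in> X"
  proof (rule ex1I[of _ \<rho>])
    show "\<rho> \<in> rep_list M n \<and> cocycle_line ?A \<rho> \<in> X" using \<rho> mem by blast
    fix \<rho>' assume \<rho>': "\<rho>' \<in> rep_list M n \<and> cocycle_line ?A \<rho>' \<in> X"
    then have "cocycle_equiv ?A \<rho>' \<rho>"
      using mem cocycle_equiv_sym[OF algebra_mu0] cocycle_equiv_trans[OF _ \<rho>(2) algebra_mu0] by blast
    then show "\<rho>' = \<rho>"
      using representatives_inequivalent[OF n] rep_list_subset[OF n] \<rho> \<rho>' by blast
  qed
qed

theorem theorem5p19:
  fixes n :: nat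
    and A :: "('f::{alg_closed_field, field_char_0}, nat \<Rightarrow> 'f) nalg"
    and E :: "('f, 'e::ab_group_add) nalg"
    and s :: "'f \<Rightarrow> 'w::ab_group_add \<Rightarrow> 'w"
  assumes "n \<ge> 2" and "A = mu0 n"
  shows "(\<forall>M.
      parameterizes_orbits M A (rep_list M n) \<and>
      (\<forall>\<theta>\<in>rep_list M n. nonsplit_central_extension_ann1 M A (*) (ext A (*) \<theta>)) \<and>
      (\<forall>\<theta>\<in>rep_list M n. \<forall>\<theta>'\<in>rep_list M n.
         isomorphic (ext A (*) \<theta>) (ext A (*) \<theta>') \<longrightarrow> \<theta> = \<theta>') \<and>
      (nonsplit_central_extension_ann1 M A s E \<longrightarrow>
         (\<exists>\<theta>\<in>rep_list M n. isomorphic E (ext A (*) \<theta>)))) \<and>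
    isomorphic (ext A (*) (nabla n n)) (mu0 (n + 1) :: ('f, nat \<Rightarrow> 'f) nalg)"
proof (intro conjI allI ballI impI)
  note n = assms(1)
  have alg: "algebra A" using algebra_mu0 assms(2) by simp
  fix M
  show "parameterizes_orbits M A (rep_list M n)"
    using rep_list_parameterizes_orbits[OF n] assms(2) by blast
  show "nonsplit_central_extension_ann1 M A (*) (ext A (*) \<theta>)" if "\<theta> \<in> rep_list M n" for \<theta>
  proof (rule nonsplit_ext_ann1[OF alg])
    have "bvec n n \<in> Ann A" "bvec n n \<noteq> (0 :: nat \<Rightarrow> 'f)"
      using n assms(2) by (auto simp: Ann_mu0 bvec_def fun_eq_iff)
    then show "Ann A \<noteq> {0}" by blast
  qed (use assms that in_variety_mu0 rep_list_in_Z2 rep_list_admissible(1) in blast)+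
  show "\<theta> = \<theta>'"
    if \<theta>: "\<theta> \<in> rep_list M n" and \<theta>': "\<theta>' \<in> rep_list M n"
      and iso: "isomorphic (ext A (*) \<theta>) (ext A (*) \<theta>')" for \<theta> \<theta>'
  proof -
    have bil: "bilinear_from A (*) \<rho>" if "\<rho> \<in> rep_list M n" for \<rho>
      using Z2_LC_D(1)[OF Z2_in_LC[OF rep_list_in_Z2[OF n that]]] assms(2) by simp
    have "cocycle_equiv A \<theta>' \<theta>"
      using rep_list_admissible(1)[OF n] \<theta> \<theta>' iso assms(2)
      by (intro cocycle_equiv_if_isomorphic_ext[OF alg bil bil]) auto
    then show "\<theta> = \<theta>'"
      using representatives_inequivalent[OF n] rep_list_subset[OF n] \<theta> \<theta>' assms(2) by blast
  qed
  show "\<exists>\<theta>\<in>rep_list M n. isomorphic E (ext A (*) \<theta>)" if E: "nonsplit_central_extension_ann1 M A s E"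
  proof -
    obtain \<eta> where \<eta>: "\<eta> \<in> Z2 M A (*)" "isomorphic E (ext A (*) \<eta>)" "Ann_cocycle A \<eta> \<inter> Ann A = {0}"
      using nonsplit_central_extension_cocycle[OF alg E] by blast
    obtain \<rho> where \<rho>: "\<rho> \<in> rep_list M n" "cocycle_equiv A \<eta> \<rho>"
      using exists_representative_Ann[of \<eta> M n] \<eta> n assms(2) by blast
    have "isomorphic (ext A (*) \<eta>) (ext A (*) \<rho>)"
      using isomorphic_ext_if_cocycle_equiv[OF alg cocycle_equiv_sym[OF alg \<rho>(2)]] .
    then show ?thesis using \<rho>(1) isomorphic_trans[OF \<eta>(2)] by blast
  qed
next
  show "isomorphic (ext A (*) (nabla n n)) (mu0 (n + 1) :: ('f, nat \<Rightarrow> 'f) nalg)"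
    using isomorphic_ext_nabla_mu0 assms(2) by blast
qed

end
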